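(* There exist right-angled Artin groups $A$ and finitely presented subgroups $P<A$ such that $P$ has an exponential Dehn function.
   Context: A right angled Artin group is a group given by a presentation of the form $A=\langle v_1,\dots,v_n \mid [v_i,v_j]=1 \ \forall (i,j)\in E\rangle$, where $E$ is the edge set of a finite graph with vertex set $\{1,\dots,n\}$. Let $\Gamma=\langle X\mid R\rangle$ be a finitely presented group. For a word $w$ in the free group $F(X)$ with $w=1$ in $\Gamma$, $\mathrm{Area}(w)$ is the least integer $N$ for which there is an equality $w=\prod_{i=1}^N\theta_i r_i^{\pm1}\theta_i^{-1}$ in $F(X)$ with $r_i\in R$ and $\theta_i\in F(X)$. The Dehn function of $\langle X\mid R\rangle$ is $\delta(n)=\max\{\mathrm{Area}(w)\mid w=_\Gamma 1,\ |w|\le n\}$, where $|w|$ is word length. Growth of Dehn functions is considered up to the usual equivalence: $f\preceq g$ if there is a constant $C>0$ with $f(n)\le C g(Cn+C)+Cn+C$ for all $n$, and $f\simeq g$ if $f\preceq g$ and $g\preceq f$; up to $\simeq$ the Dehn function is independent of the finite presentation. A Dehn function is exponential if it is $\simeq 2^n$. *)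

theory Defs
  imports "HOL-Algebra.Generated_Groups"
begin

section \<open>Free groups\<close>

text \<open>The letter \<open>(x, True)\<close> stands for the generator \<open>x\<close> and \<open>(x, False)\<close> for its formal inverse.
  Elements of the free group are the freely reduced words, so the word length of an element is the
  length of the list representing it.\<close>

type_synonym 'x letter = "'x \<times> bool"

definition inv_letter :: "'x letter \<Rightarrow> 'x letter" where
  "inv_letter a = (fst a, \<not> snd a)"

definition reduced :: "'x letter list \<Rightarrow> bool" where
  "reduced w \<longleftrightarrow> successively (\<lambda>a b. b \<noteq> inv_letter a) w"

fun red_cons :: "'x letter \<Rightarrow> 'x letter list \<Rightarrow> 'x letter list" where
  "red_cons a [] = [a]"
| "red_cons a (b # w) = (if b = inv_letter a then w else a # b # w)"

definition reduce :: "'x letter list \<Rightarrow> 'x letter list" where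
  "reduce w = foldr red_cons w []"

definition free_group :: "'x set \<Rightarrow> 'x letter list monoid" where
  "free_group X = \<lparr>carrier = {w. fst ` set w \<subseteq> X \<and> reduced w},
                   monoid.mult = (\<lambda>u v. reduce (u @ v)), one = []\<rparr>"

definition free_gen :: "'x \<Rightarrow> 'x letter list" where
  "free_gen x = [(x, True)]"

lemma inv_letter_simps [simp]:
  "inv_letter (inv_letter a) = a" "fst (inv_letter a) = fst a" "inv_letter a \<noteq> a" "a \<noteq> inv_letter a"
  by (auto simp: inv_letter_def prod_eq_iff)

lemma reduced_Nil [simp]: "reduced []"
  by (simp add: reduced_def)

lemma reduced_red_cons: "reduced w \<Longrightarrow> reduced (red_cons a w)"
  by (cases w) (auto simp: reduced_def successively_Cons)

lemma reduced_foldr: "reduced v \<Longrightarrow> reduced (foldr red_cons u v)"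
  by (induction u) (auto simp: reduced_red_cons)

lemma foldr_red_cons_reduced: "reduced (u @ v) \<Longrightarrow> foldr red_cons u v = u @ v"
proof (induction u)
  case (Cons a u)
  then have "foldr red_cons u v = u @ v"
    by (auto simp: reduced_def successively_Cons)
  with Cons.prems show ?case
    by (cases "u @ v") (auto simp: reduced_def)
qed auto

lemma reduce_append: "reduced v \<Longrightarrow> reduce (u @ v) = foldr red_cons u v"
  using foldr_red_cons_reduced[of v "[]"] by (simp add: reduce_def)

lemma reduce_reduced: "reduced w \<Longrightarrow> reduce w = w"
  using foldr_red_cons_reduced[of w "[]"] by (simp add: reduce_def)

lemma red_cons_inv: "reduced w \<Longrightarrow> red_cons a (red_cons (inv_letter a) w) = w"
  by (cases w rule: remdups_adj.cases) (auto simp: reduced_def)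

lemma foldr_red_cons_assoc:
  "reduced w \<Longrightarrow> foldr red_cons (foldr red_cons u v) w = foldr red_cons u (foldr red_cons v w)"
proof (induction u)
  case (Cons a u)
  have "foldr red_cons (red_cons a t) w = red_cons a (foldr red_cons t w)" for t
    using Cons.prems red_cons_inv[of "foldr red_cons (tl t) w" a]
    by (cases t) (auto simp: reduced_foldr)
  with Cons show ?case by simp
qed auto

lemma set_red_cons: "set (red_cons a w) \<subseteq> insert a (set w)"
  by (cases w) auto

lemma set_foldr_red_cons: "set (foldr red_cons u v) \<subseteq> set u \<union> set v"
proof (induction u)
  case (Cons a u)
  then show ?case using set_red_cons[of a "foldr red_cons u v"] by auto
qed auto

lemma foldr_red_cons_inverse:
  "reduced w \<Longrightarrow> foldr red_cons (rev (map inv_letter u)) (foldr red_cons u w) = w"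
proof (induction u)
  case (Cons a u)
  then show ?case
    using red_cons_inv[of "foldr red_cons u w" "inv_letter a"] by (simp add: reduced_foldr)
qed auto

lemma reduced_inverse: "reduced u \<Longrightarrow> reduced (rev (map inv_letter u))"
  unfolding reduced_def successively_rev successively_map
  by (erule successively_mono) (auto simp: inv_letter_def prod_eq_iff)

lemma group_free_group: "group (free_group X)"
proof (rule groupI)
  show "x \<otimes>\<^bsub>free_group X\<^esub> y \<in> carrier (free_group X)"
    if "x \<in> carrier (free_group X)" "y \<in> carrier (free_group X)" for x y
    using that set_foldr_red_cons[of x y]
    by (fastforce simp: free_group_def reduce_append reduced_foldr)
  show "x \<otimes>\<^bsub>free_group X\<^esub> y \<otimes>\<^bsub>free_group X\<^esub> z
      = x \<otimes>\<^bsub>free_group X\<^esub> (y \<otimes>\<^bsub>free_group X\<^esub> z)"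
    if "x \<in> carrier (free_group X)" "y \<in> carrier (free_group X)" "z \<in> carrier (free_group X)"
    for x y z
    using that by (simp add: free_group_def reduce_append reduced_foldr foldr_red_cons_assoc)
  show "\<exists>y\<in>carrier (free_group X). y \<otimes>\<^bsub>free_group X\<^esub> x = \<one>\<^bsub>free_group X\<^esub>"
    if "x \<in> carrier (free_group X)" for x
    using that foldr_red_cons_inverse[of "[]" x] foldr_red_cons_reduced[of x "[]"]
    by (intro bexI[of _ "rev (map inv_letter x)"])
       (auto simp: free_group_def reduce_append reduced_inverse)
qed (auto simp: free_group_def reduce_reduced)


section \<open>Group presentations\<close>

definition normal_closure :: "('g, 'm) monoid_scheme \<Rightarrow> 'g set \<Rightarrow> 'g set" where
  "normal_closure G R =
     generate G {\<theta> \<otimes>\<^bsub>G\<^esub> r \<otimes>\<^bsub>G\<^esub> inv\<^bsub>G\<^esub> \<theta> | \<theta> r. \<theta> \<in> carrier G \<and> r \<in> R}"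

definition presented_group :: "'x set \<Rightarrow> 'x letter list set \<Rightarrow> 'x letter list set monoid" where
  "presented_group X R = free_group X Mod normal_closure (free_group X) R"

definition finite_presentation ::
    "('g, 'm) monoid_scheme \<Rightarrow> 'x set \<Rightarrow> 'x letter list set \<Rightarrow> bool" where
  "finite_presentation G X R \<longleftrightarrow>
     finite X \<and> finite R \<and> R \<subseteq> carrier (free_group X) \<and> presented_group X R \<cong> G"

lemma (in group) normal_normal_closure:
  assumes "R \<subseteq> carrier G"
  shows "normal_closure G R \<lhd> G"
  unfolding normal_closure_def
proof (rule normal_generateI)
  fix h g
  assume "h \<in> {\<theta> \<otimes> r \<otimes> inv \<theta> | \<theta> r. \<theta> \<in> carrier G \<and> r \<in> R}" and g: "g \<in> carrier G"
  then obtain \<theta> r where h: "h = \<theta> \<otimes> r \<otimes> inv \<theta>" "\<theta> \<in> carrier G" "r \<in> R" by blast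
  then have "g \<otimes> h \<otimes> inv g = (g \<otimes> \<theta>) \<otimes> r \<otimes> inv (g \<otimes> \<theta>)"
    using assms g by (simp add: subset_iff m_assoc inv_mult_group)
  with h g show "g \<otimes> h \<otimes> inv g \<in> {\<theta> \<otimes> r \<otimes> inv \<theta> | \<theta> r. \<theta> \<in> carrier G \<and> r \<in> R}"
    by blast
qed (use assms in auto)

lemma group_presented_group:
  "R \<subseteq> carrier (free_group X) \<Longrightarrow> group (presented_group X R)"
  unfolding presented_group_def
  by (intro normal.factorgroup_is_group group.normal_normal_closure group_free_group)


section \<open>Right-angled Artin groups\<close>

text \<open>The edge set of a finite simple graph with vertex set \<open>{1..n}\<close> is given as a symmetric,
  irreflexive relation.\<close>

definition graph_on :: "nat \<Rightarrow> (nat \<times> nat) set \<Rightarrow> bool" where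
  "graph_on n E \<longleftrightarrow> E \<subseteq> {1..n} \<times> {1..n} \<and> sym E \<and> irrefl E"

definition commutator :: "('g, 'm) monoid_scheme \<Rightarrow> 'g \<Rightarrow> 'g \<Rightarrow> 'g" where
  "commutator G a b = a \<otimes>\<^bsub>G\<^esub> b \<otimes>\<^bsub>G\<^esub> inv\<^bsub>G\<^esub> a \<otimes>\<^bsub>G\<^esub> inv\<^bsub>G\<^esub> b"

definition RAAG :: "nat \<Rightarrow> (nat \<times> nat) set \<Rightarrow> nat letter list set monoid" where
  "RAAG n E = presented_group {1..n}
     {commutator (free_group {1..n}) (free_gen i) (free_gen j) | i j. (i, j) \<in> E}"

lemma free_gen_in_free_group: "x \<in> X \<Longrightarrow> free_gen x \<in> carrier (free_group X)"
  by (simp add: free_gen_def free_group_def reduced_def)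

lemma (in group) commutator_closed:
  "a \<in> carrier G \<Longrightarrow> b \<in> carrier G \<Longrightarrow> commutator G a b \<in> carrier G"
  by (simp add: commutator_def)

lemma group_RAAG: "graph_on n E \<Longrightarrow> group (RAAG n E)"
  unfolding RAAG_def graph_on_def
  by (intro group_presented_group)
     (auto intro!: group.commutator_closed group_free_group free_gen_in_free_group)


section \<open>Dehn functions\<close>

definition trivial_in :: "'x set \<Rightarrow> 'x letter list set \<Rightarrow> 'x letter list \<Rightarrow> bool" where
  "trivial_in X R w \<longleftrightarrow>
     w \<in> carrier (free_group X) \<and>
     normal_closure (free_group X) R #>\<^bsub>free_group X\<^esub> w = \<one>\<^bsub>presented_group X R\<^esub>"

definition relator_conjugates :: "('g, 'm) monoid_scheme \<Rightarrow> 'g set \<Rightarrow> 'g set" where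
  "relator_conjugates G R =
     {\<theta> \<otimes>\<^bsub>G\<^esub> s \<otimes>\<^bsub>G\<^esub> inv\<^bsub>G\<^esub> \<theta> | \<theta> s. \<theta> \<in> carrier G \<and> s \<in> R \<union> m_inv G ` R}"

definition area :: "'x set \<Rightarrow> 'x letter list set \<Rightarrow> 'x letter list \<Rightarrow> nat" where
  "area X R w = (LEAST N. \<exists>cs. length cs = N \<and> set cs \<subseteq> relator_conjugates (free_group X) R \<and>
     w = foldr (\<otimes>\<^bsub>free_group X\<^esub>) cs \<one>\<^bsub>free_group X\<^esub>)"

definition dehn_function :: "'x set \<Rightarrow> 'x letter list set \<Rightarrow> nat \<Rightarrow> nat" where
  "dehn_function X R n = Max {area X R w | w. trivial_in X R w \<and> length w \<le> n}"

definition growth_le :: "(nat \<Rightarrow> nat) \<Rightarrow> (nat \<Rightarrow> nat) \<Rightarrow> bool" (infix \<open>\<preceq>\<^sub>D\<close> 50) where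
  "f \<preceq>\<^sub>D g \<longleftrightarrow> (\<exists>C>0. \<forall>n. f n \<le> C * g (C * n + C) + C * n + C)"

definition growth_equiv :: "(nat \<Rightarrow> nat) \<Rightarrow> (nat \<Rightarrow> nat) \<Rightarrow> bool" (infix \<open>\<simeq>\<^sub>D\<close> 50) where
  "f \<simeq>\<^sub>D g \<longleftrightarrow> f \<preceq>\<^sub>D g \<and> g \<preceq>\<^sub>D f"

text \<open>The least number in \<open>area\<close> and the maximum in \<open>dehn_function\<close> exist.\<close>

lemma trivial_in_iff:
  assumes "R \<subseteq> carrier (free_group X)"
  shows "trivial_in X R w \<longleftrightarrow> w \<in> normal_closure (free_group X) R"
proof -
  interpret F: group "free_group X" by (rule group_free_group)
  interpret N: normal "normal_closure (free_group X) R" "free_group X"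
    by (rule F.normal_normal_closure[OF assms])
  show ?thesis
    using F.coset_join1[OF _ _ N.subgroup_axioms, of w] F.coset_join2[OF _ N.subgroup_axioms, of w]
      N.subset
    unfolding trivial_in_def presented_group_def one_FactGroup by blast
qed

lemma area_exists:
  assumes R: "R \<subseteq> carrier (free_group X)" and w: "trivial_in X R w"
  shows "\<exists>cs. length cs = area X R w \<and> set cs \<subseteq> relator_conjugates (free_group X) R \<and>
     w = foldr (\<otimes>\<^bsub>free_group X\<^esub>) cs \<one>\<^bsub>free_group X\<^esub>"
proof -
  let ?F = "free_group X" and ?C = "relator_conjugates (free_group X) R"
  interpret F: group ?F by (rule group_free_group)
  have C: "?C \<subseteq> carrier ?F"
    using R by (auto simp: relator_conjugates_def)
  have conj: "\<theta> \<otimes>\<^bsub>?F\<^esub> r \<otimes>\<^bsub>?F\<^esub> inv\<^bsub>?F\<^esub> \<theta> \<in> ?C" "inv\<^bsub>?F\<^esub> (\<theta> \<otimes>\<^bsub>?F\<^esub> r \<otimes>\<^bsub>?F\<^esub> inv\<^bsub>?F\<^esub> \<theta>) \<in> ?C"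
    if "\<theta> \<in> carrier ?F" "r \<in> R" for \<theta> r
  proof -
    have "inv\<^bsub>?F\<^esub> (\<theta> \<otimes>\<^bsub>?F\<^esub> r \<otimes>\<^bsub>?F\<^esub> inv\<^bsub>?F\<^esub> \<theta>) = \<theta> \<otimes>\<^bsub>?F\<^esub> inv\<^bsub>?F\<^esub> r \<otimes>\<^bsub>?F\<^esub> inv\<^bsub>?F\<^esub> \<theta>"
      using that R by (simp add: subset_iff F.m_assoc F.inv_mult_group)
    then show "\<theta> \<otimes>\<^bsub>?F\<^esub> r \<otimes>\<^bsub>?F\<^esub> inv\<^bsub>?F\<^esub> \<theta> \<in> ?C" "inv\<^bsub>?F\<^esub> (\<theta> \<otimes>\<^bsub>?F\<^esub> r \<otimes>\<^bsub>?F\<^esub> inv\<^bsub>?F\<^esub> \<theta>) \<in> ?C"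
      using that unfolding relator_conjugates_def by blast+
  qed
  have closed: "foldr (\<otimes>\<^bsub>?F\<^esub>) cs \<one>\<^bsub>?F\<^esub> \<in> carrier ?F" if "set cs \<subseteq> ?C" for cs
    using that C by (induction cs) auto
  have append: "foldr (\<otimes>\<^bsub>?F\<^esub>) (cs @ ds) \<one>\<^bsub>?F\<^esub>
      = foldr (\<otimes>\<^bsub>?F\<^esub>) cs \<one>\<^bsub>?F\<^esub> \<otimes>\<^bsub>?F\<^esub> foldr (\<otimes>\<^bsub>?F\<^esub>) ds \<one>\<^bsub>?F\<^esub>"
    if "set cs \<subseteq> ?C" "set ds \<subseteq> ?C" for cs ds
    using that(1)
  proof (induction cs)
    case (Cons c cs)
    then show ?case using C closed that(2) by (simp add: F.m_assoc subset_iff)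
  qed (use closed that in auto)
  have decomp: "\<exists>cs. set cs \<subseteq> ?C \<and> v = foldr (\<otimes>\<^bsub>?F\<^esub>) cs \<one>\<^bsub>?F\<^esub>"
    if "v \<in> normal_closure ?F R" for v
    using that unfolding normal_closure_def
  proof (induction v rule: generate.induct)
    case one
    show ?case by (intro exI[of _ "[]"]) simp
  next
    case (incl h)
    then have "h \<in> ?C" using conj by blast
    then show ?case using C by (intro exI[of _ "[h]"]) auto
  next
    case (inv h)
    then have "inv\<^bsub>?F\<^esub> h \<in> ?C" using conj by blast
    then show ?case using C by (intro exI[of _ "[inv\<^bsub>?F\<^esub> h]"]) auto
  next
    case (eng h1 h2)
    then obtain cs ds where "set cs \<subseteq> ?C" "h1 = foldr (\<otimes>\<^bsub>?F\<^esub>) cs \<one>\<^bsub>?F\<^esub>"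
      "set ds \<subseteq> ?C" "h2 = foldr (\<otimes>\<^bsub>?F\<^esub>) ds \<one>\<^bsub>?F\<^esub>" by blast
    then show ?case using append[of cs ds] by (intro exI[of _ "cs @ ds"]) simp
  qed
  have "\<exists>N cs. length cs = N \<and> set cs \<subseteq> ?C \<and> w = foldr (\<otimes>\<^bsub>?F\<^esub>) cs \<one>\<^bsub>?F\<^esub>"
    using decomp[of w] w trivial_in_iff[OF R] by simp
  then show ?thesis
    unfolding area_def by (rule LeastI_ex)
qed

lemma finite_dehn_set:
  assumes "finite X"
  shows "finite {area X R w | w. trivial_in X R w \<and> length w \<le> n}"
proof -
  have "{w. trivial_in X R w \<and> length w \<le> n} \<subseteq> {w. set w \<subseteq> X \<times> UNIV \<and> length w \<le> n}"
    by (auto simp: trivial_in_def free_group_def)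
  then have "finite {w. trivial_in X R w \<and> length w \<le> n}"
    by (rule finite_subset) (simp add: assms finite_lists_length_le)
  then show ?thesis by simp
qed

lemma trivial_in_Nil: "R \<subseteq> carrier (free_group X) \<Longrightarrow> trivial_in X R []"
  using generate.one[of "free_group X"]
  by (simp add: trivial_in_iff normal_closure_def) (simp add: free_group_def)

end

theory Submission
  imports Defs
begin

text \<open>Let \<open>W\<close> be the right-angled Coxeter group and \<open>A\<close> the right-angled Artin group of the 1-skeleton of the
  cube, whose vertices are coloured black and white. Letting the exponents of the letters of each colour alternate
  embeds the index-four subgroup of \<open>W\<close> that is even in both colours into \<open>A\<close>. This subgroup
  (the group of a hyperbolic 3-manifold) is an extension \<open>N \<rtimes> \<langle>t\<rangle>\<close>, where \<open>N\<close> is free of rank five (a six-punctured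
  sphere is the fibre) and \<open>t\<close> acts as a pseudo-Anosov. The product of \<open>A\<close> with the free group on \<open>x, y\<close> contains
  \<open>P = N \<rtimes> F(s, t)\<close>, generated by \<open>N\<close>, \<open>s = x\<close> and \<open>t\<close> times \<open>y\<close>, where \<open>s\<close> acts trivially on \<open>N\<close>.

  That \<open>N\<close> is free in \<open>A\<close> follows from an action of \<open>A\<close> on two copies of the free group of rank five under
  which \<open>N\<close> acts by inner automorphisms. Pushing the stable letters of a word to the right costs an
  exponential number of relators and leaves a word that is trivial in a free group; this gives both the finite
  presentation and the upper bound. For the lower bound, \<open>(\<int>\<^sup>2 \<rtimes> \<plusminus>1) \<rtimes> F(s, t)\<close> is a quotient of \<open>P\<close> with \<open>t\<close> hyperbolic on
  \<open>\<int>\<^sup>2\<close>; letting \<open>s\<close> act on \<open>\<int>\<^sup>3\<close> by a shear instead of trivially, every relator becomes a translation by at most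
  one along the last axis, while \<open>[s, t\<^sup>n a t\<^sup>-\<^sup>n]\<close> becomes a translation by at least \<open>2\<^sup>n\<close>.\<close>

section \<open>Words and free groups\<close>

definition word_inv :: "'x letter list \<Rightarrow> 'x letter list" where
  "word_inv w = rev (map inv_letter w)"

definition words :: "'x set \<Rightarrow> 'x letter list set" where
  "words X = {w. fst ` set w \<subseteq> X}"

lemma word_inv_simps [simp]:
  "word_inv [] = []" "word_inv (a # w) = word_inv w @ [inv_letter a]"
  "word_inv (u @ v) = word_inv v @ word_inv u" "word_inv (word_inv w) = w"
  "length (word_inv w) = length w"
  by (simp_all add: word_inv_def rev_map o_def)

lemma words_simps [simp]:
  "[] \<in> words X" "a # w \<in> words X \<longleftrightarrow> fst a \<in> X \<and> w \<in> words X"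
  "u @ v \<in> words X \<longleftrightarrow> u \<in> words X \<and> v \<in> words X"
  "word_inv w \<in> words X \<longleftrightarrow> w \<in> words X"
  by (auto simp: words_def word_inv_def image_image)

lemma words_mono: "X \<subseteq> Y \<Longrightarrow> w \<in> words X \<Longrightarrow> w \<in> words Y"
  by (auto simp: words_def)

lemma reduced_reduce [simp]: "reduced (reduce w)"
  by (simp add: reduce_def reduced_foldr)

lemma reduce_Nil [simp]: "reduce [] = []"
  by (simp add: reduce_def)

lemma reduce_in_words [simp]: "w \<in> words X \<Longrightarrow> reduce w \<in> words X"
  using set_foldr_red_cons[of w "[]"] by (auto simp: words_def reduce_def)

lemma reduce_append_foldr: "reduce (u @ v) = foldr red_cons u (reduce v)"
  by (simp add: reduce_def)

lemma reduce_append_right [simp]: "reduce (u @ reduce v) = reduce (u @ v)"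
  by (simp add: reduce_append_foldr reduce_reduced)

lemma reduce_append_left [simp]: "reduce (reduce u @ v) = reduce (u @ v)"
proof -
  have "foldr red_cons (reduce u) (reduce v) = foldr red_cons u (reduce v)"
    using foldr_red_cons_assoc[of "reduce v" u "[]"] by (simp add: reduce_def reduced_foldr)
  then show ?thesis by (simp add: reduce_append_foldr)
qed

lemma reduce_infix: "reduce (p @ reduce u @ q) = reduce (p @ u @ q)"
  using reduce_append_right[of p "reduce u @ q"] reduce_append_right[of p "u @ q"] by simp

lemma reduce_reduce [simp]: "reduce (reduce w) = reduce w"
  by (simp add: reduce_reduced)

lemma reduce_cong_append:
  "reduce u = reduce u' \<Longrightarrow> reduce v = reduce v' \<Longrightarrow> reduce (u @ v) = reduce (u' @ v')"
  by (metis reduce_append_left reduce_append_right)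

lemma reduce_left_inv: "reduce (word_inv u @ u @ v) = reduce v"
  using foldr_red_cons_inverse[of "reduce v" u] by (simp add: reduce_append_foldr word_inv_def)

lemma reduce_right_inv: "reduce (u @ word_inv u @ v) = reduce v"
  using reduce_left_inv[of "word_inv u" v] by simp

lemma reduce_cancel:
  "reduce (word_inv u @ u) = []" "reduce (u @ word_inv u) = []"
  using reduce_left_inv[of u "[]"] reduce_right_inv[of u "[]"] by simp_all

lemma reduce_cancel_infix:
  "reduce (p @ word_inv u @ u @ v) = reduce (p @ v)" "reduce (p @ u @ word_inv u @ v) = reduce (p @ v)"
  by (metis reduce_left_inv reduce_append_right, metis reduce_right_inv reduce_append_right)

lemma reduce_word_inv: "reduce (word_inv w) = word_inv (reduce w)"
proof -
  have "word_inv (reduce w) = reduce (word_inv (reduce w))"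
    using reduced_inverse[of "reduce w"] by (simp add: reduce_reduced word_inv_def)
  also have "\<dots> = reduce (word_inv (reduce w) @ w @ word_inv w)"
    by (metis reduce_cancel(2) reduce_append_right append_Nil2)
  also have "\<dots> = reduce (word_inv (reduce w) @ reduce w @ word_inv w)"
    by (metis reduce_append_left reduce_append_right)
  finally show ?thesis by (simp add: reduce_left_inv)
qed

lemma length_reduce: "length (reduce w) \<le> length w"
proof (induction w)
  case (Cons a w)
  have "length (red_cons a v) \<le> Suc (length v)" for v by (cases v) auto
  then show ?case using Cons by (simp add: reduce_def) (meson Suc_le_mono le_trans)
qed simp

lemma carrier_free_group: "carrier (free_group X) = {w \<in> words X. reduced w}"
  by (auto simp: free_group_def words_def)

lemma mult_free_group [simp]: "u \<otimes>\<^bsub>free_group X\<^esub> v = reduce (u @ v)"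
  by (simp add: free_group_def)

lemma one_free_group [simp]: "\<one>\<^bsub>free_group X\<^esub> = []"
  by (simp add: free_group_def)

lemma inv_free_group:
  assumes "w \<in> carrier (free_group X)"
  shows "inv\<^bsub>free_group X\<^esub> w = word_inv w"
proof -
  interpret group "free_group X" by (rule group_free_group)
  show ?thesis
    using assms reduced_inverse[of w]
    by (intro inv_equality) (auto simp: carrier_free_group reduce_cancel word_inv_def[symmetric])
qed

lemma reduce_in_carrier [simp]: "w \<in> words X \<Longrightarrow> reduce w \<in> carrier (free_group X)"
  by (simp add: carrier_free_group)

text \<open>Conjugating by a letter that differs from the first and the last one lengthens a reduced word.\<close>

lemma free_group_centreless:
  assumes v: "reduced v" "v \<in> words X" and X: "card X \<ge> 3"
    and comm: "\<And>x. x \<in> X \<Longrightarrow> reduce (v @ [(x, True)] @ word_inv v) = [(x, True)]"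
  shows "v = []"
proof (rule ccontr)
  assume "v \<noteq> []"
  have "\<not> X \<subseteq> {fst (hd v), fst (last v)}"
    using card_mono[of "{fst (hd v), fst (last v)}" X] X card_insert_le_m1[of 2 "{fst (last v)}" "fst (hd v)"]
    by auto
  then obtain x where x: "x \<in> X" "x \<noteq> fst (hd v)" "x \<noteq> fst (last v)" by blast
  have "reduced (v @ [(x, True)] @ word_inv v)"
    using v(1) reduced_inverse[OF v(1)] \<open>v \<noteq> []\<close> x
    unfolding reduced_def word_inv_def successively_append_iff
    by (auto simp: successively_Cons hd_rev last_map inv_letter_def)
  then have "v @ [(x, True)] @ word_inv v = [(x, True)]"
    using comm[OF x(1)] by (simp add: reduce_reduced)
  with \<open>v \<noteq> []\<close> show False by (cases v) auto
qed

section \<open>Actions of words\<close>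

text \<open>Mutually inverse maps for opposite letters make \<open>foldr h\<close> an action of the
  free group, the last letter of a word acting first. The instances below act on two copies of the
  fibre, on the free factor and on integer triples.\<close>

locale word_action =
  fixes h :: "'x letter \<Rightarrow> 's \<Rightarrow> 's" and S :: "'s set"
  assumes closed: "x \<in> S \<Longrightarrow> h a x \<in> S"
    and cancel: "x \<in> S \<Longrightarrow> h a (h (inv_letter a) x) = x"
begin

lemma act_closed: "x \<in> S \<Longrightarrow> foldr h w x \<in> S"
  by (induction w) (auto simp: closed)

lemma act_reduce: "x \<in> S \<Longrightarrow> foldr h (reduce w) x = foldr h w x"
proof (induction w)
  case (Cons a w)
  have "foldr h (red_cons a v) x = h a (foldr h v x)" for v
    using cancel[of "foldr h (tl v) x" a] act_closed[OF Cons.prems]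
    by (cases v) auto
  with Cons show ?case by (simp add: reduce_def)
qed simp

lemma act_word_inv: "x \<in> S \<Longrightarrow> foldr h (word_inv w) (foldr h w x) = x"
proof -
  assume "x \<in> S"
  then show ?thesis
    using act_reduce[of x "word_inv w @ w"] reduce_cancel(1)[of w] by simp
qed

lemma act_trivial_word_inv:
  assumes "\<And>x. x \<in> S \<Longrightarrow> foldr h w x = x" "x \<in> S"
  shows "foldr h (word_inv w) x = x"
  using act_word_inv[OF assms(2), of w] assms by simp

text \<open>A conjugate of a relator acts as a conjugate of the identity, so the action descends to
  the presented group.\<close>

lemma normal_closure_acts_trivially:
  assumes R: "R \<subseteq> carrier (free_group X)" "\<And>r x. r \<in> R \<Longrightarrow> x \<in> S \<Longrightarrow> foldr h r x = x"
    and w: "w \<in> normal_closure (free_group X) R" and x: "x \<in> S"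
  shows "foldr h w x = x"
proof -
  interpret group "free_group X" by (rule group_free_group)
  have conj: "foldr h (\<theta> \<otimes>\<^bsub>free_group X\<^esub> r \<otimes>\<^bsub>free_group X\<^esub> inv\<^bsub>free_group X\<^esub> \<theta>) y = y"
    if "\<theta> \<in> carrier (free_group X)" "r \<in> R" "y \<in> S" for \<theta> r y
    using that R act_word_inv[of y "word_inv \<theta>"]
    by (simp add: inv_free_group act_reduce act_closed)
  show ?thesis
    using w x unfolding normal_closure_def
  proof (induction arbitrary: x rule: generate.induct)
    case (incl r)
    then show ?case using conj by blast
  next
    case (inv r)
    moreover have "r \<in> carrier (free_group X)"
      using inv R(1) by (auto simp: subset_iff simp del: mult_free_group)
    ultimately show ?case using conj act_trivial_word_inv[of r x]
      by (auto simp: inv_free_group simp del: mult_free_group)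
  qed (simp_all add: act_reduce)
qed

end

section \<open>Substitutions\<close>

definition letter_image :: "('x \<Rightarrow> 'y letter list) \<Rightarrow> 'x letter \<Rightarrow> 'y letter list" where
  "letter_image T a = (if snd a then T (fst a) else word_inv (T (fst a)))"

text \<open>Left unreduced, so that it distributes over append literally; the induced homomorphism
  of free groups is \<open>reduce (expand T w)\<close>.\<close>

definition expand :: "('x \<Rightarrow> 'y letter list) \<Rightarrow> 'x letter list \<Rightarrow> 'y letter list" where
  "expand T w = concat (map (letter_image T) w)"

lemma letter_image_inv_letter: "letter_image T (inv_letter a) = word_inv (letter_image T a)"
  by (simp add: letter_image_def inv_letter_def)

lemma expand_simps [simp]:
  "expand T [] = []" "expand T (a # w) = letter_image T a @ expand T w"
  "expand T (u @ v) = expand T u @ expand T v"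
  by (simp_all add: expand_def)

lemma expand_word_inv: "expand T (word_inv w) = word_inv (expand T w)"
  by (induction w) (simp_all add: letter_image_inv_letter)

lemma letter_image_in_words:
  "(\<And>x. x \<in> X \<Longrightarrow> T x \<in> words Y) \<Longrightarrow> fst a \<in> X \<Longrightarrow> letter_image T a \<in> words Y"
  by (simp add: letter_image_def)

lemma expand_in_words:
  "(\<And>x. x \<in> X \<Longrightarrow> T x \<in> words Y) \<Longrightarrow> w \<in> words X \<Longrightarrow> expand T w \<in> words Y"
  by (induction w) (auto intro: letter_image_in_words)

text \<open>A cancelling pair of letters becomes a cancelling pair of blocks, so substitution is
  well defined on the free group.\<close>

lemma reduce_expand_reduce: "reduce (expand T (reduce w)) = reduce (expand T w)"
proof (induction w)
  case (Cons a w)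
  have "reduce (expand T (red_cons a v)) = reduce (letter_image T a @ expand T v)" for v
    by (cases v) (auto simp: letter_image_inv_letter reduce_right_inv)
  then show ?case using Cons by (simp add: reduce_def[of "a # w"] flip: reduce_def)
      (metis reduce_append_right)
qed simp

lemma reduce_letter_image_cong:
  "reduce (T (fst a)) = reduce (U (fst a)) \<Longrightarrow> reduce (letter_image T a) = reduce (letter_image U a)"
  by (simp add: letter_image_def reduce_word_inv)

lemma expand_letter_image: "expand T (letter_image U a) = letter_image (\<lambda>x. expand T (U x)) a"
  by (simp add: letter_image_def expand_word_inv)

lemma reduce_expand_expand:
  assumes "\<And>x. x \<in> X \<Longrightarrow> reduce (expand T (U x)) = reduce (V x)" "w \<in> words X"
  shows "reduce (expand T (expand U w)) = reduce (expand V w)"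
  using assms(2)
proof (induction w)
  case (Cons a w)
  then have "reduce (letter_image (\<lambda>x. expand T (U x)) a) = reduce (letter_image V a)"
    using assms(1) by (intro reduce_letter_image_cong) simp
  with Cons show ?case by (auto simp: expand_letter_image intro: reduce_cong_append)
qed simp

lemma reduce_expand_id:
  assumes "\<And>x. x \<in> X \<Longrightarrow> reduce (T x) = [(x, True)]" "w \<in> words X"
  shows "reduce (expand T w) = reduce w"
  using assms(2)
proof (induction w)
  case (Cons a w)
  then have "reduce (letter_image T a) = [a]"
    using assms(1) by (cases a) (auto simp: letter_image_def reduce_word_inv inv_letter_def)
  with Cons show ?case
    using reduce_cong_append[of "letter_image T a" "[a]" "expand T w" w]
    by (simp add: reduce_reduced reduced_def)
qed simp

section \<open>Words in presented groups\<close>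

lemma (in group) normal_closure_subset:
  assumes "N \<lhd> G" "R \<subseteq> N"
  shows "normal_closure G R \<subseteq> N"
proof -
  interpret normal N G by fact
  show ?thesis
    unfolding normal_closure_def
    using assms(2) by (intro generate_subgroup_incl subgroup_axioms) (auto intro: inv_op_closed2)
qed

locale presentation =
  fixes X :: "'x set" and R :: "'x letter list set"
  assumes relators: "R \<subseteq> carrier (free_group X)"
begin

abbreviation "Q \<equiv> presented_group X R"
abbreviation "NC \<equiv> normal_closure (free_group X) R"

text \<open>Reducing first extends the quotient map to arbitrary words.\<close>

definition cls :: "'x letter list \<Rightarrow> 'x letter list set" where
  "cls w = NC #>\<^bsub>free_group X\<^esub> reduce w"

sublocale F: group "free_group X" by (rule group_free_group)
sublocale NC: normal NC "free_group X" by (rule F.normal_normal_closure[OF relators])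
sublocale Q: group Q by (rule group_presented_group[OF relators])

lemma cls_closed [simp]: "w \<in> words X \<Longrightarrow> cls w \<in> carrier Q"
  using NC.r_coset_hom_Mod by (auto simp: cls_def presented_group_def hom_def)

lemma cls_append [simp]:
  "u \<in> words X \<Longrightarrow> v \<in> words X \<Longrightarrow> cls (u @ v) = cls u \<otimes>\<^bsub>Q\<^esub> cls v"
  using hom_mult[OF NC.r_coset_hom_Mod, of "reduce u" "reduce v"]
  by (simp add: cls_def presented_group_def)

lemma cls_Cons: "fst a \<in> X \<Longrightarrow> w \<in> words X \<Longrightarrow> cls (a # w) = cls [a] \<otimes>\<^bsub>Q\<^esub> cls w"
  using cls_append[of "[a]" w] by simp

lemma cls_cong: "reduce u = reduce v \<Longrightarrow> cls u = cls v"
  by (simp add: cls_def)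

lemma cls_Nil [simp]: "cls [] = \<one>\<^bsub>Q\<^esub>"
  using NC.subset by (simp add: cls_def presented_group_def)
    (metis F.coset_mult_one one_free_group)

lemma cls_eq_one_iff: "w \<in> words X \<Longrightarrow> cls w = \<one>\<^bsub>Q\<^esub> \<longleftrightarrow> reduce w \<in> NC"
  using trivial_in_iff[OF relators, of "reduce w"] by (simp add: cls_def trivial_in_def)

lemma cls_word_inv: "w \<in> words X \<Longrightarrow> cls (word_inv w) = inv\<^bsub>Q\<^esub> (cls w)"
  using cls_append[of "word_inv w" w] cls_cong[of "word_inv w @ w" "[]"]
  by (intro Q.inv_equality[symmetric]) (auto simp: reduce_cancel)

lemma relator_in_NC:
  assumes "r \<in> R" shows "r \<in> NC"
proof -
  have "r = \<one>\<^bsub>free_group X\<^esub> \<otimes>\<^bsub>free_group X\<^esub> r \<otimes>\<^bsub>free_group X\<^esub> inv\<^bsub>free_group X\<^esub> \<one>\<^bsub>free_group X\<^esub>"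
    using assms relators by (simp add: subset_iff del: mult_free_group one_free_group)
  then show ?thesis
    unfolding normal_closure_def using assms F.one_closed by (blast intro: generate.incl)
qed

end

section \<open>Words in right-angled Artin groups\<close>

text \<open>Deletes the first \<open>a\<close> if all letters before it commute with it, that is, if
  this \<open>a\<close> could be brought to the front.\<close>

fun pull :: "(nat \<Rightarrow> nat \<Rightarrow> bool) \<Rightarrow> nat letter \<Rightarrow> nat letter list \<Rightarrow> nat letter list option" where
  "pull c a [] = None"
| "pull c a (b # w) =
     (if b = a then Some w else if c (fst b) (fst a) then map_option ((#) b) (pull c a w) else None)"

definition shuffle_cons :: "(nat \<Rightarrow> nat \<Rightarrow> bool) \<Rightarrow> nat letter \<Rightarrow> nat letter list \<Rightarrow> nat letter list" where
  "shuffle_cons c a w = (case pull c (inv_letter a) w of None \<Rightarrow> a # w | Some v \<Rightarrow> v)"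

text \<open>Executable cancellation modulo commutations. An empty result certifies triviality in the
  Artin group, see \<open>cls_eq_one_if_shuffle\<close>.\<close>

fun shuffle :: "(nat \<Rightarrow> nat \<Rightarrow> bool) \<Rightarrow> nat letter list \<Rightarrow> nat letter list" where
  "shuffle c [] = []"
| "shuffle c (a # w) = shuffle_cons c a (shuffle c w)"

definition raag_relators :: "nat set \<Rightarrow> (nat \<times> nat) set \<Rightarrow> nat letter list set" where
  "raag_relators V E = {commutator (free_group V) (free_gen i) (free_gen j) | i j. (i, j) \<in> E}"

lemma raag_relators_closed:
  assumes "E \<subseteq> V \<times> V" shows "raag_relators V E \<subseteq> carrier (free_group V)"
  unfolding raag_relators_def using assms
  by (auto intro!: group.commutator_closed group_free_group free_gen_in_free_group)

lemma commutator_free_gen: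
  assumes "i \<in> V" "j \<in> V"
  shows "commutator (free_group V) (free_gen i) (free_gen j)
    = reduce [(i, True), (j, True), (i, False), (j, False)]"
  using assms inv_free_group[OF free_gen_in_free_group[of i V]] inv_free_group[OF free_gen_in_free_group[of j V]]
  by (simp add: commutator_def) (simp add: free_gen_def inv_letter_def)

locale raag =
  fixes V :: "nat set" and E :: "(nat \<times> nat) set" and c :: "nat \<Rightarrow> nat \<Rightarrow> bool"
  assumes edges: "E \<subseteq> V \<times> V"
    and c: "c i j \<Longrightarrow> (i, j) \<in> E"
begin

sublocale presentation V "raag_relators V E"
  by unfold_locales (rule raag_relators_closed[OF edges])

text \<open>The relator treats two positive letters; whatever commutes with an element commutes with
  its inverse, which gives the other signs.\<close>

lemma cls_letter_commute:
  assumes "c (fst a) (fst b)"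
  shows "cls [a] \<otimes>\<^bsub>Q\<^esub> cls [b] = cls [b] \<otimes>\<^bsub>Q\<^esub> cls [a]"
proof -
  obtain i p j q where ab: "a = (i, p)" "b = (j, q)" by fastforce
  have ij: "(i, j) \<in> E" "i \<in> V" "j \<in> V" using assms c edges ab by auto
  let ?x = "cls [(i, True)]" and ?y = "cls [(j, True)]"
  have inv: "cls [(k, False)] = inv\<^bsub>Q\<^esub> (cls [(k, True)])" if "k \<in> V" for k
    using cls_word_inv[of "[(k, True)]"] that by (simp add: inv_letter_def)
  have "commutator (free_group V) (free_gen i) (free_gen j) \<in> NC"
    using ij by (intro relator_in_NC) (auto simp: raag_relators_def)
  then have "cls [(i, True), (j, True), (i, False), (j, False)] = \<one>\<^bsub>Q\<^esub>"
    using ij by (simp add: cls_eq_one_iff commutator_free_gen)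
  then have "(?x \<otimes>\<^bsub>Q\<^esub> ?y) \<otimes>\<^bsub>Q\<^esub> (inv\<^bsub>Q\<^esub> ?x \<otimes>\<^bsub>Q\<^esub> inv\<^bsub>Q\<^esub> ?y) = \<one>\<^bsub>Q\<^esub>"
    using ij by (simp add: cls_Cons[of _ "_ # _"] inv Q.m_assoc)
  then have "inv\<^bsub>Q\<^esub> (inv\<^bsub>Q\<^esub> ?x \<otimes>\<^bsub>Q\<^esub> inv\<^bsub>Q\<^esub> ?y) = ?x \<otimes>\<^bsub>Q\<^esub> ?y"
    using ij by (intro Q.inv_equality) auto
  then have comm: "?x \<otimes>\<^bsub>Q\<^esub> ?y = ?y \<otimes>\<^bsub>Q\<^esub> ?x"
    using ij by (simp add: Q.inv_mult_group)
  have comm_inv: "x \<otimes>\<^bsub>Q\<^esub> inv\<^bsub>Q\<^esub> y = inv\<^bsub>Q\<^esub> y \<otimes>\<^bsub>Q\<^esub> x"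
    if "x \<in> carrier Q" "y \<in> carrier Q" "x \<otimes>\<^bsub>Q\<^esub> y = y \<otimes>\<^bsub>Q\<^esub> x" for x y
  proof -
    have "inv\<^bsub>Q\<^esub> y \<otimes>\<^bsub>Q\<^esub> x = inv\<^bsub>Q\<^esub> y \<otimes>\<^bsub>Q\<^esub> ((x \<otimes>\<^bsub>Q\<^esub> y) \<otimes>\<^bsub>Q\<^esub> inv\<^bsub>Q\<^esub> y)"
      using that(1,2) by (simp add: Q.m_assoc)
    also have "\<dots> = inv\<^bsub>Q\<^esub> y \<otimes>\<^bsub>Q\<^esub> (y \<otimes>\<^bsub>Q\<^esub> (x \<otimes>\<^bsub>Q\<^esub> inv\<^bsub>Q\<^esub> y))"
      using that by (simp add: Q.m_assoc)
    also have "\<dots> = x \<otimes>\<^bsub>Q\<^esub> inv\<^bsub>Q\<^esub> y"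
      using that(1,2) by (simp add: Q.inv_solve_left flip: Q.m_assoc)
    finally show ?thesis by simp
  qed
  have "?x \<otimes>\<^bsub>Q\<^esub> inv\<^bsub>Q\<^esub> ?y = inv\<^bsub>Q\<^esub> ?y \<otimes>\<^bsub>Q\<^esub> ?x"
    using ij by (intro comm_inv comm) auto
  moreover have "inv\<^bsub>Q\<^esub> ?x \<otimes>\<^bsub>Q\<^esub> ?y = ?y \<otimes>\<^bsub>Q\<^esub> inv\<^bsub>Q\<^esub> ?x"
    using ij by (intro comm_inv[symmetric] comm[symmetric]) auto
  moreover from this have "inv\<^bsub>Q\<^esub> ?x \<otimes>\<^bsub>Q\<^esub> inv\<^bsub>Q\<^esub> ?y = inv\<^bsub>Q\<^esub> ?y \<otimes>\<^bsub>Q\<^esub> inv\<^bsub>Q\<^esub> ?x"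
    using ij by (intro comm_inv) auto
  ultimately have "\<forall>p q. cls [(i, p)] \<otimes>\<^bsub>Q\<^esub> cls [(j, q)] = cls [(j, q)] \<otimes>\<^bsub>Q\<^esub> cls [(i, p)]"
    unfolding all_bool_eq inv[OF ij(2)] inv[OF ij(3)] using comm by blast
  then show ?thesis by (simp only: ab)
qed

lemma cls_pull:
  "pull c a w = Some v \<Longrightarrow> fst a \<in> V \<Longrightarrow> w \<in> words V \<Longrightarrow> v \<in> words V \<and> cls w = cls [a] \<otimes>\<^bsub>Q\<^esub> cls v"
proof (induction w arbitrary: v)
  case (Cons b w)
  show ?case
  proof (cases "b = a")
    case True
    then show ?thesis using Cons.prems by (simp add: cls_Cons[of a v])
  next
    case False
    then obtain u where u: "c (fst b) (fst a)" "pull c a w = Some u" "v = b # u"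
      using Cons.prems(1) by (auto split: if_splits)
    then have IH: "u \<in> words V" "cls w = cls [a] \<otimes>\<^bsub>Q\<^esub> cls u" using Cons by auto
    have "cls (b # w) = (cls [b] \<otimes>\<^bsub>Q\<^esub> cls [a]) \<otimes>\<^bsub>Q\<^esub> cls u"
      using Cons.prems IH by (simp add: cls_Cons[of b w] Q.m_assoc)
    also have "\<dots> = cls [a] \<otimes>\<^bsub>Q\<^esub> cls v"
      unfolding cls_letter_commute[OF u(1)]
      using Cons.prems IH u(3) by (simp add: cls_Cons[of b u] Q.m_assoc)
    finally show ?thesis using Cons.prems IH u by simp
  qed
qed simp

lemma cls_shuffle_cons:
  assumes "fst a \<in> V" "w \<in> words V"
  shows "shuffle_cons c a w \<in> words V \<and> cls (shuffle_cons c a w) = cls [a] \<otimes>\<^bsub>Q\<^esub> cls w"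
proof (cases "pull c (inv_letter a) w")
  case None
  then show ?thesis using assms cls_Cons[of a w] by (simp add: shuffle_cons_def)
next
  case (Some v)
  have "cls [a] \<otimes>\<^bsub>Q\<^esub> cls [inv_letter a] = \<one>\<^bsub>Q\<^esub>"
    using cls_append[of "[a]" "[inv_letter a]"] assms cls_cong[of "[a, inv_letter a]" "[]"]
    by (simp add: reduce_def)
  with Some cls_pull[OF Some] assms show ?thesis
    by (simp add: shuffle_cons_def flip: Q.m_assoc)
qed

lemma cls_eq_one_if_shuffle:
  assumes "w \<in> words V" "shuffle c w = []"
  shows "cls w = \<one>\<^bsub>Q\<^esub>"
proof -
  have "shuffle c w \<in> words V \<and> cls (shuffle c w) = cls w"
    using assms(1)
  proof (induction w)
    case (Cons a w)
    then show ?case using cls_shuffle_cons[of a "shuffle c w"] cls_Cons[of a w] by simp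
  qed simp
  with assms(2) show ?thesis by auto
qed

text \<open>Inverse letters undo positive ones, so it is enough to compare the positive letters at
  the ends of an edge.\<close>

lemma relators_act_trivially:
  assumes "word_action h S" "r \<in> raag_relators V E" "x \<in> S"
    and comm: "\<And>i j x. (i, j) \<in> E \<Longrightarrow> x \<in> S \<Longrightarrow> h (i, True) (h (j, True) x) = h (j, True) (h (i, True) x)"
  shows "foldr h r x = x"
proof -
  interpret word_action h S by fact
  obtain i j where ij: "(i, j) \<in> E" "r = commutator (free_group V) (free_gen i) (free_gen j)"
    using assms(2) by (auto simp: raag_relators_def)
  have inverse: "h (k, True) (h (k, False) y) = y" if "y \<in> S" for k y
    using cancel[of y "(k, True)"] that by (simp add: inv_letter_def)
  have "foldr h r x = h (i, True) (h (j, True) (h (i, False) (h (j, False) x)))"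
    using ij edges assms(3) by (auto simp: commutator_free_gen act_reduce)
  also have "\<dots> = h (j, True) (h (i, True) (h (i, False) (h (j, False) x)))"
    using ij assms(3) by (intro comm) (auto simp: closed)
  finally show ?thesis using assms(3) by (simp add: inverse closed)
qed

end

section \<open>Area\<close>

context presentation
begin

text \<open>An inductive counterpart of \<open>area\<close> for unreduced words. The base case
  admits every \<open>N\<close>, so \<open>N\<close> is only an upper bound for the number of
  relators and composes easily.\<close>

inductive fills :: "nat \<Rightarrow> 'x letter list \<Rightarrow> bool" where
  trivial: "reduce w = [] \<Longrightarrow> fills N w"
| step: "g \<in> words X \<Longrightarrow> r \<in> R \<union> word_inv ` R \<Longrightarrow> fills N v \<Longrightarrow>
    reduce w = reduce (g @ r @ word_inv g @ v) \<Longrightarrow> fills (Suc N) w"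

lemma fills_cong: "fills N w \<Longrightarrow> reduce w = reduce w' \<Longrightarrow> fills N w'"
  by (cases rule: fills.cases) (auto intro: fills.intros)

lemma cls_infix_cong:
  assumes "cls u = cls u'" "p \<in> words X" "u \<in> words X" "u' \<in> words X" "q \<in> words X"
  shows "cls (p @ u @ q) = cls (p @ u' @ q)"
  using assms by simp

lemma fills_mono: "fills N w \<Longrightarrow> N \<le> M \<Longrightarrow> fills M w"
proof (induction arbitrary: M rule: fills.induct)
  case (step g r N v w)
  from step.prems obtain M' where "M = Suc M'" "N \<le> M'" by (cases M) auto
  with step.IH show ?case by (auto intro: fills.step[OF step.hyps(1,2) _ step.hyps(4)])
qed (rule fills.trivial)

lemma fills_append: "fills N u \<Longrightarrow> fills M v \<Longrightarrow> fills (N + M) (u @ v)"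
proof (induction rule: fills.induct)
  case (trivial w N)
  have "fills (N + M) v" using trivial.prems by (rule fills_mono) simp
  moreover have "reduce v = reduce (w @ v)"
    using trivial.hyps by (metis append_Nil reduce_append_left)
  ultimately show ?case by (rule fills_cong)
next
  case (step g r N x w)
  have "reduce (w @ v) = reduce (reduce w @ v)" by simp
  also have "\<dots> = reduce (g @ r @ word_inv g @ (x @ v))"
    unfolding step.hyps(4) by simp
  finally have "fills (Suc (N + M)) (w @ v)"
    by (rule fills.step[OF step.hyps(1,2) step.IH[OF step.prems]])
  then show ?case by simp
qed

lemma fills_conj: "fills N w \<Longrightarrow> g \<in> words X \<Longrightarrow> fills N (g @ w @ word_inv g)"
proof (induction rule: fills.induct)
  case (trivial w N)
  have "reduce (g @ w @ word_inv g) = reduce (g @ reduce w @ word_inv g)"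
    by (metis reduce_append_left reduce_append_right)
  with trivial show ?case by (auto intro: fills.trivial simp: reduce_cancel)
next
  case (step h r N v w)
  have "reduce (g @ w @ word_inv g) = reduce (g @ reduce w @ word_inv g)"
    by (metis reduce_append_left reduce_append_right)
  also have "\<dots> = reduce ((g @ h @ r @ word_inv h @ v) @ word_inv g)"
    unfolding step.hyps(4) by (metis reduce_append_left reduce_append_right append_assoc)
  also have "\<dots> = reduce ((g @ h) @ r @ word_inv (g @ h) @ (g @ v @ word_inv g))"
    using reduce_cancel_infix(1)[of "g @ h @ r @ word_inv h" g "v @ word_inv g"] by simp
  finally have eq: "reduce (g @ w @ word_inv g)
    = reduce ((g @ h) @ r @ word_inv (g @ h) @ (g @ v @ word_inv g))" .
  show ?case
    by (rule fills.step[OF _ step.hyps(2) step.IH[OF step.prems] eq]) (simp add: step.hyps(1) step.prems)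
qed

lemma fills_relator:
  assumes "r \<in> R" shows "fills 1 r" "fills 1 (word_inv r)"
proof -
  have "fills (Suc 0) s" if "s \<in> R \<union> word_inv ` R" for s
    by (rule fills.step[OF _ that fills.trivial[of "[]" 0], of "[]"]) simp_all
  then show "fills 1 r" "fills 1 (word_inv r)" using assms by simp_all
qed

lemma fills_word_inv: "fills N w \<Longrightarrow> fills N (word_inv w)"
proof (induction rule: fills.induct)
  case (trivial w N)
  then show ?case by (auto intro: fills.trivial simp: reduce_word_inv)
next
  case (step g r N v w)
  have "fills 1 (word_inv r)" using step.hyps(2) fills_relator by auto
  then have "fills (N + 1) (word_inv v @ (g @ word_inv r @ word_inv g))"
    using step by (intro fills_append fills_conj) auto
  moreover have "reduce (word_inv v @ (g @ word_inv r @ word_inv g)) = reduce (word_inv w)"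
    unfolding reduce_word_inv[of w] step.hyps(4) reduce_word_inv[symmetric] by simp
  ultimately show ?case by (simp add: fills_cong)
qed

lemma fills_reduce_iff: "fills N (reduce w) \<longleftrightarrow> fills N w"
  using fills_cong[of N w "reduce w"] fills_cong[of N "reduce w" w] by auto

lemma relator_or_inverse: "R \<union> m_inv (free_group X) ` R = R \<union> word_inv ` R"
  using relators by (auto simp: inv_free_group subset_iff image_iff)

lemma conj_reduce:
  assumes "g \<in> words X"
  shows "reduce g \<otimes>\<^bsub>free_group X\<^esub> r \<otimes>\<^bsub>free_group X\<^esub> inv\<^bsub>free_group X\<^esub> (reduce g)
    = reduce (g @ r @ word_inv g)"
  using assms reduce_append_right[of "g @ r" "word_inv g"]
  by (simp add: inv_free_group reduce_word_inv)

lemma fills_imp_NC: "fills N w \<Longrightarrow> reduce w \<in> NC"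
proof (induction rule: fills.induct)
  case (trivial w N)
  then show ?case using NC.one_closed by simp
next
  case (step g r N v w)
  have "r \<in> NC"
  proof (cases "r \<in> R")
    case True
    then show ?thesis by (rule relator_in_NC)
  next
    case False
    then obtain s where s: "s \<in> R" "r = word_inv s" using step.hyps(2) by blast
    have "inv\<^bsub>free_group X\<^esub> s \<in> NC" using s(1) by (intro NC.m_inv_closed relator_in_NC)
    moreover have "s \<in> carrier (free_group X)" using s(1) relators by auto
    ultimately show ?thesis by (simp add: s(2) inv_free_group)
  qed
  then have "reduce g \<otimes>\<^bsub>free_group X\<^esub> r \<otimes>\<^bsub>free_group X\<^esub> inv\<^bsub>free_group X\<^esub> (reduce g) \<in> NC"
    using step.hyps(1) by (intro NC.inv_op_closed2) auto
  then have "reduce (g @ r @ word_inv g) \<in> NC"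
    unfolding conj_reduce[OF step.hyps(1)] .
  from NC.m_closed[OF this step.IH] show ?case
    unfolding step.hyps(4) by simp
qed

lemma area_le_if_fills:
  assumes "fills N w"
  shows "area X R (reduce w) \<le> N"
proof -
  have "\<exists>cs. length cs \<le> N \<and> set cs \<subseteq> relator_conjugates (free_group X) R \<and>
     reduce w = foldr (\<otimes>\<^bsub>free_group X\<^esub>) cs \<one>\<^bsub>free_group X\<^esub>"
    using assms
  proof (induction rule: fills.induct)
    case (step g r N v w)
    then obtain cs where cs: "length cs \<le> N" "set cs \<subseteq> relator_conjugates (free_group X) R"
      "reduce v = foldr (\<otimes>\<^bsub>free_group X\<^esub>) cs \<one>\<^bsub>free_group X\<^esub>" by blast
    let ?c = "reduce g \<otimes>\<^bsub>free_group X\<^esub> r \<otimes>\<^bsub>free_group X\<^esub> inv\<^bsub>free_group X\<^esub> (reduce g)"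
    have "?c \<in> relator_conjugates (free_group X) R"
      using step.hyps(1,2) reduce_in_carrier unfolding relator_conjugates_def relator_or_inverse by blast
    moreover have "reduce w = ?c \<otimes>\<^bsub>free_group X\<^esub> reduce v"
      unfolding conj_reduce[OF step.hyps(1)] step.hyps(4) by simp
    ultimately show ?case using cs
      by (intro exI[of _ "?c # cs"]) (auto simp del: mult_free_group)
  qed (auto intro: exI[of _ "[]"])
  then obtain cs where cs: "length cs \<le> N" "set cs \<subseteq> relator_conjugates (free_group X) R"
    "reduce w = foldr (\<otimes>\<^bsub>free_group X\<^esub>) cs \<one>\<^bsub>free_group X\<^esub>" by blast
  then have "area X R (reduce w) \<le> length cs"
    unfolding area_def by (blast intro: Least_le)
  with cs(1) show ?thesis by simp
qed

text \<open>Together with \<open>area_le_if_fills\<close> this transfers bounds between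
  \<open>fills\<close> and \<open>area\<close>.\<close>

lemma fills_area:
  assumes "trivial_in X R w"
  shows "fills (area X R w) w"
proof -
  have "fills (length cs) (foldr (\<otimes>\<^bsub>free_group X\<^esub>) cs \<one>\<^bsub>free_group X\<^esub>)"
    if "set cs \<subseteq> relator_conjugates (free_group X) R" for cs
    using that
  proof (induction cs)
    case (Cons d cs)
    then obtain \<theta> r where \<theta>: "\<theta> \<in> carrier (free_group X)" "r \<in> R \<union> word_inv ` R"
      "d = \<theta> \<otimes>\<^bsub>free_group X\<^esub> r \<otimes>\<^bsub>free_group X\<^esub> inv\<^bsub>free_group X\<^esub> \<theta>"
      by (auto simp: relator_conjugates_def relator_or_inverse simp del: mult_free_group)
    have IH: "fills (length cs) (foldr (\<otimes>\<^bsub>free_group X\<^esub>) cs \<one>\<^bsub>free_group X\<^esub>)"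
      by (rule Cons.IH) (use Cons.prems in auto)
    have "\<theta> \<in> words X" "d = reduce (\<theta> @ r @ word_inv \<theta>)"
      using \<theta>(1,3) by (simp_all add: inv_free_group carrier_free_group)
    then have "fills (Suc (length cs)) (d @ foldr (\<otimes>\<^bsub>free_group X\<^esub>) cs \<one>\<^bsub>free_group X\<^esub>)"
      by (intro fills.step[OF _ \<theta>(2) IH]) simp_all
    then show ?case
      unfolding foldr.simps o_apply mult_free_group[of _ d] length_Cons fills_reduce_iff .
  qed (auto intro: fills.trivial)
  with area_exists[OF relators assms] show ?thesis by metis
qed

end

section \<open>Free-by-free groups\<close>

text \<open>Data of a semidirect product of the free groups on \<open>Y\<close> and
  \<open>Z\<close>: the stable letter \<open>c\<close> acts by the automorphism
  \<open>\<sigma> c\<close>, which the opposite letter inverts, and \<open>L\<close> bounds how much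
  a word is stretched.\<close>

locale free_by_free =
  fixes Y Z :: "'x set" and \<sigma> :: "'x letter \<Rightarrow> 'x \<Rightarrow> 'x letter list" and L :: nat
  assumes finite: "finite Y" "finite Z"
    and \<sigma>_words: "\<And>c x. fst c \<in> Z \<Longrightarrow> x \<in> Y \<Longrightarrow> \<sigma> c x \<in> words Y"
    and \<sigma>_inverse: "\<And>c x. fst c \<in> Z \<Longrightarrow> x \<in> Y \<Longrightarrow> reduce (expand (\<sigma> c) (\<sigma> (inv_letter c) x)) = [(x, True)]"
    and \<sigma>_length: "\<And>c x. fst c \<in> Z \<Longrightarrow> x \<in> Y \<Longrightarrow> length (\<sigma> c x) \<le> L"
    and two_le_L: "2 \<le> L"
begin

text \<open>Relators are given for positive stable letters only; the relations for the inverse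
  letters are derived in \<open>pushes_letter\<close>.\<close>

definition Rel :: "'x letter list set" where
  "Rel = (\<lambda>(z, x). reduce ([(z, True), (x, True), (z, False)] @ word_inv (\<sigma> (z, True) x))) ` (Z \<times> Y)"

lemma finite_Rel: "finite Rel"
  by (simp add: Rel_def finite)

sublocale presentation "Y \<union> Z" Rel
  by unfold_locales (auto simp: Rel_def \<sigma>_words words_mono[of Y])

text \<open>The cost of moving \<open>c\<close> to the right past \<open>v\<close>, which turns
  \<open>v\<close> into \<open>expand (\<sigma> c) v\<close>.\<close>

definition pushes :: "nat \<Rightarrow> 'x letter \<Rightarrow> 'x letter list \<Rightarrow> bool" where
  "pushes N c v = fills N (c # v @ inv_letter c # word_inv (expand (\<sigma> c) v))"

lemma expand_\<sigma>_words: "fst c \<in> Z \<Longrightarrow> v \<in> words Y \<Longrightarrow> expand (\<sigma> c) v \<in> words Y"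
  by (rule expand_in_words) (auto simp: \<sigma>_words)

lemma length_expand_\<sigma>: "fst c \<in> Z \<Longrightarrow> v \<in> words Y \<Longrightarrow> length (expand (\<sigma> c) v) \<le> L * length v"
proof (induction v)
  case (Cons a v)
  moreover have "length (letter_image (\<sigma> c) a) \<le> L"
    using Cons.prems \<sigma>_length by (simp add: letter_image_def)
  ultimately show ?case by simp
qed simp

text \<open>The error word of \<open>u @ v\<close> is that of \<open>u\<close> times the one of
  \<open>v\<close> conjugated by the image of \<open>u\<close>.\<close>

lemma pushes_append:
  assumes "pushes N c u" "pushes M c v" and c: "fst c \<in> Z" "u \<in> words Y"
  shows "pushes (N + M) c (u @ v)"
proof -
  let ?u = "expand (\<sigma> c) u" and ?v = "expand (\<sigma> c) v"
  have "fills (N + M) ((c # u @ inv_letter c # word_inv ?u) @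
      (?u @ (c # v @ inv_letter c # word_inv ?v) @ word_inv ?u))"
    using assms expand_\<sigma>_words[OF c] words_mono[of Y "Y \<union> Z"]
    by (intro fills_append fills_conj) (auto simp: pushes_def)
  moreover have "reduce ((c # u @ inv_letter c # word_inv ?u) @
        (?u @ (c # v @ inv_letter c # word_inv ?v) @ word_inv ?u))
      = reduce (c # (u @ v) @ inv_letter c # word_inv (expand (\<sigma> c) (u @ v)))"
    using reduce_cancel_infix(1)[of "c # u @ [inv_letter c]" ?u
        "(c # v @ inv_letter c # word_inv ?v) @ word_inv ?u"]
      reduce_cancel_infix(1)[of "c # u" "[c]" "(v @ inv_letter c # word_inv ?v) @ word_inv ?u"]
    by simp
  ultimately show ?thesis unfolding pushes_def by (rule fills_cong)
qed

lemma pushes_word_inv: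
  assumes "pushes N c v" and c: "fst c \<in> Z" "v \<in> words Y"
  shows "pushes N c (word_inv v)"
proof -
  let ?v = "expand (\<sigma> c) v"
  have "fills N (word_inv ?v @ word_inv (c # v @ inv_letter c # word_inv ?v) @ word_inv (word_inv ?v))"
    using assms expand_\<sigma>_words[OF c] words_mono[of Y "Y \<union> Z"]
    by (intro fills_word_inv fills_conj) (auto simp: pushes_def)
  then show ?thesis
    using reduce_left_inv[of ?v "c # word_inv v @ inv_letter c # ?v"]
    by (auto simp: pushes_def expand_word_inv intro: fills_cong)
qed

lemma pushes_if_pushes_letters:
  assumes "\<And>x. x \<in> Y \<Longrightarrow> pushes N c [(x, True)]" and c: "fst c \<in> Z" "v \<in> words Y"
  shows "pushes (N * length v) c v"
  using c(2)
proof (induction v)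
  case Nil
  show ?case using reduce_cancel(2)[of "[c]"] by (auto simp: pushes_def intro: fills.trivial)
next
  case (Cons a v)
  then have "pushes N c [a]"
    using assms(1)[of "fst a"] pushes_word_inv[of N c "[(fst a, True)]"] c(1)
    by (cases a; cases "snd a") (auto simp: inv_letter_def)
  then show ?case using pushes_append[of N c "[a]" "N * length v" v] Cons c(1) by simp
qed

text \<open>For an inverse stable_set letter, \<open>t\<inverse> x t = \<sigma>\<inverse>(x)\<close> is obtained by conjugating
  \<open>t \<sigma>\<inverse>(x) t\<inverse> = \<sigma>(\<sigma>\<inverse>(x)) = x\<close>, which takes one relator for every letter of \<open>\<sigma>\<inverse>(x)\<close>.\<close>

lemma pushes_letter:
  assumes c: "fst c \<in> Z" and x: "x \<in> Y"
  shows "pushes L c [(x, True)]"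
proof -
  have positive: "pushes 1 (z, True) [(y, True)]" if "z \<in> Z" "y \<in> Y" for z y
  proof -
    have "reduce ([(z, True), (y, True), (z, False)] @ word_inv (\<sigma> (z, True) y)) \<in> Rel"
      using that by (auto simp: Rel_def)
    from fills_relator(1)[OF this] show ?thesis
      unfolding fills_reduce_iff by (simp add: pushes_def letter_image_def inv_letter_def)
  qed
  obtain z b where zb: "c = (z, b)" "z \<in> Z" using c by (cases c) auto
  show ?thesis
  proof (cases b)
    case True
    then show ?thesis
      using positive[OF zb(2) x] zb(1) two_le_L fills_mono[of 1 _ L] by (simp add: pushes_def)
  next
    case False
    let ?t = "(z, True)" and ?v = "\<sigma> c x"
    have v: "?v \<in> words Y" "length ?v \<le> L" using \<sigma>_words \<sigma>_length c x by auto
    have c': "inv_letter c = ?t" "inv_letter ?t = c" using zb False by (auto simp: inv_letter_def)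
    have "pushes (length ?v) ?t ?v"
      using pushes_if_pushes_letters[of 1 ?t ?v] positive zb v by simp
    then have fills: "fills L (word_inv [c] @ ?v @ [c] @ word_inv (expand (\<sigma> ?t) ?v))"
      using v(2) by (simp add: pushes_def c' fills_mono)
    have "reduce (expand (\<sigma> ?t) ?v) = [(x, True)]"
      using \<sigma>_inverse[of ?t x] zb x c' by simp
    then have "reduce (word_inv (expand (\<sigma> ?t) ?v)) = reduce [(x, False)]"
      unfolding reduce_word_inv by (simp add: inv_letter_def reduce_def)
    then have "reduce ((word_inv [c] @ ?v @ [c]) @ word_inv (expand (\<sigma> ?t) ?v))
        = reduce ((word_inv [c] @ ?v @ [c]) @ [(x, False)])"
      by (rule reduce_cong_append[OF refl])
    with fills have "fills L (word_inv [c] @ ?v @ [c] @ [(x, False)])"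
      by (auto elim!: fills_cong)
    then have "fills L ([c] @ (word_inv [c] @ ?v @ [c] @ [(x, False)]) @ word_inv [c])"
      using c by (intro fills_conj) auto
    then have "fills L (?v @ [c] @ [(x, False)] @ word_inv [c])"
      by (rule fills_cong) (use reduce_right_inv[of "[c]"] in simp)
    then have "fills L (word_inv (?v @ [c] @ [(x, False)] @ word_inv [c]))"
      by (rule fills_word_inv)
    then show ?thesis by (simp add: pushes_def letter_image_def inv_letter_def)
  qed
qed

lemma pushes: "fst c \<in> Z \<Longrightarrow> v \<in> words Y \<Longrightarrow> pushes (L * length v) c v"
  by (rule pushes_if_pushes_letters) (auto intro: pushes_letter)

lemma cls_conj_stable:
  assumes "fst c \<in> Z" "v \<in> words Y"
  shows "cls (c # v @ [inv_letter c]) = cls (expand (\<sigma> c) v)"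
proof -
  have v: "v \<in> words (Y \<union> Z)" "expand (\<sigma> c) v \<in> words (Y \<union> Z)"
    using assms(2) expand_\<sigma>_words[OF assms] by (auto intro: words_mono[of Y])
  have "cls ((c # v @ [inv_letter c]) @ word_inv (expand (\<sigma> c) v)) = \<one>\<^bsub>Q\<^esub>"
    using fills_imp_NC[OF pushes[OF assms, unfolded pushes_def]] assms(1) v
    by (subst cls_eq_one_iff) auto
  then have "cls (c # v @ [inv_letter c]) \<otimes>\<^bsub>Q\<^esub> inv\<^bsub>Q\<^esub> cls (expand (\<sigma> c) v) = \<one>\<^bsub>Q\<^esub>"
    using assms(1) v by (subst (asm) cls_append) (auto simp: cls_word_inv)
  then show ?thesis using assms(1) v by (subst (asm) Q.inv_solve_right') auto
qed

lemma cls_conj_stable_power: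
  assumes "fst c \<in> Z" "v \<in> words Y"
  shows "\<exists>v' \<in> words Y. cls (replicate n c @ v @ replicate n (inv_letter c)) = cls v'"
proof (induction n)
  case 0
  show ?case using assms by auto
next
  case (Suc n)
  let ?w = "replicate n c @ v @ replicate n (inv_letter c)"
  obtain v' where v': "v' \<in> words Y" "cls ?w = cls v'" using Suc by blast
  have words: "v' \<in> words (Y \<union> Z)" "?w \<in> words (Y \<union> Z)"
    using assms v'(1) by (auto simp: words_def image_subset_iff inv_letter_def)
  have "replicate (Suc n) c @ v @ replicate (Suc n) (inv_letter c) = [c] @ ?w @ [inv_letter c]"
    by (simp add: replicate_append_same)
  also have "cls \<dots> = cls ([c] @ v' @ [inv_letter c])"
    by (rule cls_infix_cong) (use assms(1) words v'(2) in simp_all)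
  also have "\<dots> = cls (expand (\<sigma> c) v')" using cls_conj_stable[OF assms(1) v'(1)] by simp
  finally show ?case using expand_\<sigma>_words[OF assms(1) v'(1)] by metis
qed

text \<open>Induction from the left: a letter of \<open>Y\<close> joins \<open>v\<close>; a stable
  letter is pushed past \<open>v\<close>, at a cost of at most \<open>L * length v\<close>, and
  stretches \<open>v\<close> by at most the factor \<open>L\<close>.\<close>

lemma normal_form:
  "w \<in> words (Y \<union> Z) \<Longrightarrow> \<exists>v\<in>words Y. \<exists>u\<in>words Z. length v \<le> L ^ length w \<and>
     fills (L ^ Suc (length w)) (w @ word_inv (v @ u))"
proof (induction w)
  case Nil
  show ?case by (intro bexI[of _ "[]"]) (auto intro: fills.trivial)
next
  case (Cons c w)
  then obtain v u where vu: "v \<in> words Y" "u \<in> words Z" "length v \<le> L ^ length w"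
    "fills (L ^ Suc (length w)) (w @ word_inv (v @ u))" by auto
  have c: "[c] \<in> words (Y \<union> Z)" using Cons.prems by simp
  have fills_c: "fills (L ^ Suc (length w)) ([c] @ (w @ word_inv (v @ u)) @ word_inv [c])"
    by (rule fills_conj[OF vu(4) c])
  have double: "N + N \<le> L * N" for N
    using mult_le_mono1[OF two_le_L, of N] unfolding mult_2 .
  show ?case
  proof (cases "fst c \<in> Z")
    case False
    then have "fst c \<in> Y" using c by simp
    moreover have "length (c # v) \<le> L ^ length (c # w)"
    proof -
      have "1 \<le> L ^ length w" using two_le_L by simp
      then show ?thesis using vu(3) double[of "L ^ length w"] by simp
    qed
    moreover have "fills (L ^ Suc (length (c # w))) ((c # w) @ word_inv ((c # v) @ u))"
      using fills_mono[OF fills_c, of "L ^ Suc (length (c # w))"] two_le_L by simp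
    ultimately show ?thesis using vu(1,2) by (intro bexI[of _ "c # v"] bexI[of _ u]) auto
  next
    case True
    let ?v = "expand (\<sigma> c) v"
    \<comment> \<open>The push obeys the same bound as the filling of the rest; one further factor
      \<open>L\<close>, being at least 2, pays for both.\<close>
    have "L * length v \<le> L ^ Suc (length w)" using vu(3) by simp
    then have "fills (L ^ Suc (length w)) (c # v @ inv_letter c # word_inv ?v)"
      using pushes[OF True vu(1)] fills_mono unfolding pushes_def by blast
    from fills_append[OF fills_c this]
    have "fills (L ^ Suc (length (c # w)))
      (([c] @ (w @ word_inv (v @ u)) @ word_inv [c]) @ (c # v @ inv_letter c # word_inv ?v))"
      by (rule fills_mono) (use double[of "L ^ Suc (length w)"] in simp)
    moreover have "reduce (([c] @ (w @ word_inv (v @ u)) @ word_inv [c]) @ (c # v @ inv_letter c # word_inv ?v))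
        = reduce ((c # w) @ word_inv (?v @ (c # u)))"
      using reduce_cancel_infix(1)[of "c # w @ word_inv u @ word_inv v" "[c]" "v @ inv_letter c # word_inv ?v"]
        reduce_cancel_infix(1)[of "c # w @ word_inv u" v "inv_letter c # word_inv ?v"]
      by simp
    ultimately have "fills (L ^ Suc (length (c # w))) ((c # w) @ word_inv (?v @ (c # u)))"
      by (rule fills_cong)
    moreover have "length ?v \<le> L ^ length (c # w)"
      using length_expand_\<sigma>[OF True vu(1)] vu(3) by (simp add: le_trans[OF _ mult_le_mono2])
    ultimately show ?thesis
      using True vu(2) expand_\<sigma>_words[OF True vu(1)] by (intro bexI[of _ ?v] bexI[of _ "c # u"]) auto
  qed
qed

end

section \<open>Finite presentation and exponential upper bound\<close>

text \<open>As every word has a normal form, faithfulness on the products \<open>v @ u\<close> makes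
  \<open>Rel\<close> present the image of \<open>e\<close>.\<close>

locale faithful_free_by_free = free_by_free Y Z \<sigma> L + H: group H
  for Y Z :: "'x set" and \<sigma> L and H :: "('g, 'm) monoid_scheme" (structure) +
  fixes e :: "'x letter list \<Rightarrow> 'g"
  assumes hom: "e \<in> hom (free_group (Y \<union> Z)) H"
    and e_relators: "r \<in> Rel \<Longrightarrow> e r = \<one>"
    and faithful: "v \<in> words Y \<Longrightarrow> u \<in> words Z \<Longrightarrow> e (reduce (v @ u)) = \<one> \<Longrightarrow> reduce (v @ u) = []"
begin

sublocale group_hom "free_group (Y \<union> Z)" H e
  by unfold_locales (rule hom)

lemma NC_subset_kernel: "NC \<subseteq> kernel (free_group (Y \<union> Z)) H e"
  using relators e_relators
  by (intro F.normal_closure_subset normal_kernel) (auto simp: kernel_def)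

text \<open>The normal form of \<open>w\<close> is killed by \<open>e\<close> too, hence freely
  trivial; the filling from \<open>normal_form\<close> is then one of \<open>w\<close>
  itself.\<close>

lemma fills_if_kernel:
  assumes w: "w \<in> words (Y \<union> Z)" "e (reduce w) = \<one>"
  shows "fills (L ^ Suc (length w)) w"
proof -
  obtain v u where vu: "v \<in> words Y" "u \<in> words Z"
    "fills (L ^ Suc (length w)) (w @ word_inv (v @ u))" using normal_form[OF w(1)] by auto
  then have words: "v @ u \<in> words (Y \<union> Z)" by (auto intro: words_mono[of _ "Y \<union> Z"])
  have "e (reduce w \<otimes>\<^bsub>free_group (Y \<union> Z)\<^esub> inv\<^bsub>free_group (Y \<union> Z)\<^esub> (reduce (v @ u))) = \<one>"
    using fills_imp_NC[OF vu(3)] NC_subset_kernel words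
    by (auto simp: kernel_def inv_free_group simp flip: reduce_word_inv)
  then have "\<one> \<otimes> inv (e (reduce (v @ u))) = \<one>"
    using w words by (simp del: mult_free_group)
  then have "e (reduce (v @ u)) = \<one>"
    using words by (metis H.inv_inv H.inv_one H.l_one hom_closed reduce_in_carrier H.inv_closed)
  then have "reduce (v @ u) = []" using faithful vu by blast
  then have "reduce (w @ word_inv (v @ u)) = reduce (w @ [])"
    using reduce_word_inv[of "v @ u"] by (intro reduce_cong_append) (simp_all only: word_inv_simps reduce_Nil)
  with vu(3) show ?thesis by (auto elim: fills_cong)
qed

lemma kernel_eq: "kernel (free_group (Y \<union> Z)) H e = NC"
proof
  show "kernel (free_group (Y \<union> Z)) H e \<subseteq> NC"
  proof
    fix w assume "w \<in> kernel (free_group (Y \<union> Z)) H e"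
    then have "w \<in> words (Y \<union> Z)" "e (reduce w) = \<one>" "reduce w = w"
      by (auto simp: kernel_def carrier_free_group reduce_reduced)
    with fills_imp_NC[OF fills_if_kernel] show "w \<in> NC" by metis
  qed
qed (rule NC_subset_kernel)

lemma finite_presentation_image:
  "finite_presentation (H\<lparr>carrier := e ` carrier (free_group (Y \<union> Z))\<rparr>) (Y \<union> Z) Rel"
proof -
  let ?H = "H\<lparr>carrier := e ` carrier (free_group (Y \<union> Z))\<rparr>"
  interpret im: group ?H by (rule H.subgroup_imp_group[OF img_is_subgroup])
  interpret im: group_hom "free_group (Y \<union> Z)" ?H e
    using hom by unfold_locales (auto simp: hom_def)
  have "kernel (free_group (Y \<union> Z)) ?H e = NC"
    using kernel_eq by (simp add: kernel_def)
  moreover have "free_group (Y \<union> Z) Mod kernel (free_group (Y \<union> Z)) ?H e \<cong> ?H"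
    using im.FactGroup_iso by simp
  ultimately show ?thesis
    unfolding finite_presentation_def presented_group_def
    using finite finite_Rel relators by simp
qed

lemma area_le:
  assumes "trivial_in (Y \<union> Z) Rel w"
  shows "area (Y \<union> Z) Rel w \<le> L ^ Suc (length w)"
proof -
  have w: "w \<in> words (Y \<union> Z)" "reduce w = w"
    using assms by (auto simp: trivial_in_def carrier_free_group reduce_reduced)
  have "e (reduce w) = \<one>"
    using assms NC_subset_kernel w by (auto simp: trivial_in_iff[OF relators] kernel_def)
  from area_le_if_fills[OF fills_if_kernel[OF w(1) this]] w(2) show ?thesis by simp
qed

lemma dehn_function_le_exponential: "dehn_function (Y \<union> Z) Rel \<preceq>\<^sub>D (\<lambda>k. 2 ^ k)"
  unfolding growth_le_def
proof (intro exI[of _ L] conjI allI)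
  show "0 < L" using two_le_L by simp
  fix n
  have "dehn_function (Y \<union> Z) Rel n \<le> L ^ Suc n"
    unfolding dehn_function_def
  proof (rule Max.boundedI)
    show "finite {area (Y \<union> Z) Rel w |w. trivial_in (Y \<union> Z) Rel w \<and> length w \<le> n}"
      by (rule finite_dehn_set) (simp add: finite)
    show "{area (Y \<union> Z) Rel w |w. trivial_in (Y \<union> Z) Rel w \<and> length w \<le> n} \<noteq> {}"
      using trivial_in_Nil[OF relators] by force
    fix a assume "a \<in> {area (Y \<union> Z) Rel w |w. trivial_in (Y \<union> Z) Rel w \<and> length w \<le> n}"
    then obtain w where w: "a = area (Y \<union> Z) Rel w" "trivial_in (Y \<union> Z) Rel w" "length w \<le> n"
      by blast
    have "L ^ Suc (length w) \<le> L ^ Suc n" using w(3) two_le_L by (intro power_increasing) auto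
    with area_le[OF w(2)] w(1) show "a \<le> L ^ Suc n" by (metis le_trans)
  qed
  \<comment> \<open>Passing to base 2 costs a factor \<open>L\<close> in the exponent, which is why
    \<open>L\<close> serves as the constant.\<close>
  also have "L ^ Suc n \<le> (2 ^ L) ^ Suc n" by (intro power_mono) (auto simp: less_imp_le)
  also have "\<dots> = 2 ^ (L * n + L)" by (simp add: power_mult[symmetric] power_add[symmetric] algebra_simps)
  also have "\<dots> \<le> L * 2 ^ (L * n + L)" using two_le_L by simp
  also have "\<dots> \<le> L * 2 ^ (L * n + L) + L * n + L" by simp
  finally show "dehn_function (Y \<union> Z) Rel n \<le> L * 2 ^ (L * n + L) + L * n + L" .
qed

end

section \<open>The free group of rank five\<close>

text \<open>The composite with \<open>U\<close> applied first, reduced so that evaluation on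
  generators can decide equality.\<close>

definition subst_comp :: "('y \<Rightarrow> 'z letter list) \<Rightarrow> ('x \<Rightarrow> 'y letter list) \<Rightarrow> 'x \<Rightarrow> 'z letter list" where
  "subst_comp T U x = reduce (expand T (U x))"

definition inner :: "'x letter list \<Rightarrow> 'x \<Rightarrow> 'x letter list" where
  "inner g x = reduce (g @ [(x, True)] @ word_inv g)"

text \<open>In the Coxeter group \<open>W\<close> of the cube graph write \<open>b\<^sub>i\<close> and \<open>w\<^sub>j\<close> for the reflections; the vertices are
  numbered \<open>1, \<dots>, 8\<close> in the order \<open>b\<^sub>1, \<dots>, b\<^sub>4, w\<^sub>1, \<dots>, w\<^sub>4\<close>. The free generators \<open>1, \<dots>, 5\<close> of the
  fibre are \<open>w\<^sub>2 w\<^sub>4\<close>, \<open>b\<^sub>1 b\<^sub>2\<close>, \<open>b\<^sub>1 w\<^sub>2 w\<^sub>1 b\<^sub>3\<close>, \<open>b\<^sub>3 b\<^sub>4\<close>, \<open>w\<^sub>1 w\<^sub>3\<close>. The next two substitutions are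
  conjugation by \<open>b\<^sub>1 b\<^sub>3\<close> and by \<open>b\<^sub>1 w\<^sub>2\<close>.\<close>

definition monodromy :: "nat \<Rightarrow> nat letter list" where
  "monodromy x =
    (if x = 2 then [(1, False), (3, True), (5, True), (2, True), (5, False), (3, False), (1, True)]
     else if x = 3 then [(3, True), (5, True), (2, True), (5, False), (2, False)]
     else if x = 4 then [(3, True), (4, True), (3, False)]
     else if x = 5 then [(3, True), (4, False), (3, False), (2, True), (5, True), (2, False),
       (3, True), (4, True), (3, False)]
     else [(x, True)])"

definition reflection :: "nat \<Rightarrow> nat letter list" where
  "reflection x =
    (if x = 2 then [(1, True), (2, False), (1, False)]
     else if x = 4 then [(3, True), (4, False), (3, False)]
     else if x = 5 then [(3, True), (4, True), (5, False), (4, False), (3, False)]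
     else [(x, False)])"

text \<open>In \<open>W\<close> the involution \<open>b\<^sub>1 w\<^sub>2\<close> conjugates
  \<open>b\<^sub>1 b\<^sub>3\<close> to its inverse, because \<open>w\<^sub>2\<close> commutes with
  both factors.\<close>

definition monodromy_inv :: "nat \<Rightarrow> nat letter list" where
  "monodromy_inv = subst_comp reflection (subst_comp monodromy reflection)"

text \<open>Conjugation by the reflection of a vertex exchanges the fibre with its conjugate by \<open>b\<^sub>1\<close>. Identifying
  the latter with the fibre by means of \<open>b\<^sub>1\<close>, one obtains automorphisms \<open>\<theta>\<^sub>i\<close> of the fibre, namely conjugation by
  \<open>b\<^sub>1\<close> times the \<open>i\<close>-th reflection. The flag selects \<open>\<theta>\<^sub>i\<close> (if true) or its inverse.\<close>

definition vertex_iso :: "nat \<Rightarrow> bool \<Rightarrow> nat \<Rightarrow> nat letter list" where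
  "vertex_iso i b =
    (if i = 1 then (\<lambda>x. [(x, True)])
     else if i = 2 then inner [(2, b)]
     else if i = 3 then (if b then monodromy else monodromy_inv)
     else if i = 4 then (if b then subst_comp monodromy (inner [(4, True)])
       else subst_comp (inner [(4, False)]) monodromy_inv)
     else if i = 5 then (if b then subst_comp monodromy (subst_comp reflection (inner [(3, True)]))
       else subst_comp (inner [(3, False)]) (subst_comp reflection monodromy_inv))
     else if i = 6 then reflection
     else if i = 7 then (if b then subst_comp monodromy (subst_comp reflection (inner [(3, True), (5, True)]))
       else subst_comp (inner [(5, False), (3, False)]) (subst_comp reflection monodromy_inv))
     else (if b then subst_comp reflection (inner [(1, True)])
       else subst_comp (inner [(1, False)]) reflection))"

text \<open>The cube graph as a complete bipartite graph without a perfect matching: a black vertex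
  misses only its antipode. Edges are listed from black to white.\<close>

definition cube_adj :: "nat \<Rightarrow> nat \<Rightarrow> bool" where
  "cube_adj i j \<longleftrightarrow> 1 \<le> i \<and> i \<le> 4 \<and> 5 \<le> j \<and> j \<le> 8 \<and> j \<noteq> i + 4"

definition base_list :: "nat list" where "base_list = [1, 2, 3, 4, 5]"

text \<open>Joining two non-adjacent vertices to the cube graph multiplies its Artin group by a free
  group of rank two.\<close>

definition raag_adj :: "nat \<Rightarrow> nat \<Rightarrow> bool" where
  "raag_adj i j \<longleftrightarrow> cube_adj i j \<or> cube_adj j i \<or> 1 \<le> i \<and> i \<le> 8 \<and> (j = 9 \<or> j = 10) \<or>
     1 \<le> j \<and> j \<le> 8 \<and> (i = 9 \<or> i = 10)"

text \<open>The vertices \<open>9\<close> and \<open>10\<close> are the two generators of the free factor; the same names are used for the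
  stable_set letters of the subgroup, whose images are \<open>9\<close> and \<open>v\<^sub>1 v\<^sub>3\<inverse>\<close> times \<open>10\<close>.\<close>

definition gen_word :: "nat \<Rightarrow> nat letter list" where
  "gen_word x =
    (if x = 1 then [(6, True), (8, False)]
     else if x = 2 then [(1, True), (2, False)]
     else if x = 3 then [(1, True), (6, True), (5, False), (3, False)]
     else if x = 4 then [(3, True), (4, False)]
     else if x = 5 then [(5, True), (7, False)]
     else if x = 10 then [(1, True), (3, False), (10, True)]
     else [(x, True)])"

definition stable_iso :: "nat letter \<Rightarrow> nat \<Rightarrow> nat letter list" where
  "stable_iso c = (if fst c = 10 then if snd c then monodromy else monodromy_inv else (\<lambda>x. [(x, True)]))"

text \<open>The exponent of the letter is irrelevant, since the action factors through the Coxeter group.\<close>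

definition swap_act :: "nat letter \<Rightarrow> bool \<times> nat letter list \<Rightarrow> bool \<times> nat letter list" where
  "swap_act a = (\<lambda>(s, w). if fst a \<le> 8 then (\<not> s, reduce (expand (vertex_iso (fst a) (\<not> s)) w)) else (s, w))"

text \<open>This and \<open>swap_img\<close> tabulate the effect of a word on the flag and on
  generators, making identities between actions finite computations.\<close>

fun swap_sign :: "nat letter list \<Rightarrow> bool \<Rightarrow> bool" where
  "swap_sign [] s = s"
| "swap_sign (a # p) s = (if fst a \<le> 8 then \<not> swap_sign p s else swap_sign p s)"

fun swap_img :: "nat letter list \<Rightarrow> bool \<Rightarrow> nat \<Rightarrow> nat letter list" where
  "swap_img [] s x = [(x, True)]"
| "swap_img (a # p) s x = (if fst a \<le> 8 then subst_comp (vertex_iso (fst a) (\<not> swap_sign p s)) (swap_img p s) x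
     else swap_img p s x)"

section \<open>Identities verified by evaluation\<close>

lemma stable_iso_check:
  "list_all (\<lambda>c. list_all (\<lambda>x. 
     list_all (\<lambda>a. a \<in> set base_list) (map fst (stable_iso c x)) \<and> length (stable_iso c x) \<le> 31 \<and>
     reduce (expand (stable_iso c) (stable_iso (inv_letter c) x)) = [(x, True)]) base_list)
   [(9, True), (9, False), (10, True), (10, False)]"
  by code_simp

text \<open>The relators of the subgroup hold in the Artin group: their images cancel up to
  commutations.\<close>

lemma gen_word_check:
  "list_all (\<lambda>z. list_all (\<lambda>x. shuffle raag_adj
      (expand gen_word ([(z, True), (x, True), (z, False)] @ word_inv (stable_iso (z, True) x))) = []) base_list)
   [9, 10]"
  by code_simp

text \<open>The range includes 0 because \<open>swap_act\<close> treats every index up to 8 as a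
  reflection; 0 falls under the last case of \<open>vertex_iso\<close>.\<close>

lemma swap_closed_check:
  "list_all (\<lambda>i. list_all (\<lambda>s. list_all (\<lambda>x.
     list_all (\<lambda>a. a \<in> set base_list) (map fst (vertex_iso i s x))) base_list) [True, False]) [0..<9]"
  by code_simp

text \<open>This allows a letter and its inverse to act alike.\<close>

lemma swap_involution_check:
  "list_all (\<lambda>i. list_all (\<lambda>s. list_all (\<lambda>x.
     swap_img [(i, True), (i, True)] s x = [(x, True)]) base_list) [True, False]) [0..<9]"
  by code_simp

lemma swap_commute_check:
  "list_all (\<lambda>i. list_all (\<lambda>j. cube_adj i j \<longrightarrow> list_all (\<lambda>s. list_all (\<lambda>x.
     swap_img [(i, True), (j, True)] s x = swap_img [(j, True), (i, True)] s x) base_list) [True, False]) [5..<9])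
   [1..<5]"
  by code_simp

text \<open>On the copy with flag \<open>False\<close>, each fibre generator acts as conjugation by
  itself.\<close>

lemma swap_gen_word_check:
  "list_all (\<lambda>y. list_all (\<lambda>b. list_all (\<lambda>x.
     swap_img (letter_image gen_word (y, b)) False x = inner [(y, b)] x) base_list) [True, False]) base_list"
  by code_simp

abbreviation base_set :: "nat set" where "base_set \<equiv> set base_list"

lemma base_set_eq: "base_set = {1, 2, 3, 4, 5}"
  by (auto simp: base_list_def)

definition stable_list :: "nat list" where "stable_list = [9, 10]"

abbreviation stable_set :: "nat set" where "stable_set \<equiv> set stable_list"

lemma stable_set_eq: "stable_set = {9, 10}"
  by (auto simp: stable_list_def)

lemma in_stable_set [simp]: "9 \<in> stable_set" "10 \<in> stable_set"
  by (simp_all add: stable_set_eq)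

lemma reduce_expand_cong_on:
  assumes "\<And>x. x \<in> X \<Longrightarrow> reduce (T x) = reduce (U x)" "w \<in> words X"
  shows "reduce (expand T w) = reduce (expand U w)"
  using assms(2)
proof (induction w)
  case (Cons a w)
  then have "reduce (letter_image T a) = reduce (letter_image U a)"
    using assms(1) by (intro reduce_letter_image_cong) simp
  with Cons show ?case by (auto intro: reduce_cong_append)
qed simp

lemma reduce_expand_inner: "reduce (expand (inner g) w) = reduce (g @ w @ word_inv g)"
proof (induction w)
  case Nil
  show ?case by (simp add: reduce_cancel)
next
  case (Cons a w)
  have "reduce (letter_image (inner g) a) = reduce (g @ [a] @ word_inv g)"
    by (cases a) (auto simp: letter_image_def inner_def reduce_word_inv[symmetric] inv_letter_def)
  from reduce_cong_append[OF this Cons] show ?case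
    using reduce_cancel_infix(1)[of "g @ [a]" g "w @ word_inv g"] by simp
qed

section \<open>The right-angled Artin group of the cube graph\<close>

lemma swap_act_eq:
  assumes "reduced w"
  shows "foldr swap_act p (s, w) = (swap_sign p s, reduce (expand (swap_img p s) w))"
proof (induction p)
  case Nil
  have "reduce (expand (\<lambda>x. [(x, True)]) w) = reduce w"
    by (rule reduce_expand_id[of UNIV]) (auto simp: words_def reduce_reduced reduced_def)
  then show ?case using assms by (simp add: reduce_reduced)
next
  case (Cons a p)
  let ?V = "vertex_iso (fst a) (\<not> swap_sign p s)"
  have "reduce (expand ?V (expand (swap_img p s) w)) = reduce (expand (\<lambda>x. subst_comp ?V (swap_img p s) x) w)"
    by (rule reduce_expand_expand[of UNIV]) (auto simp: words_def subst_comp_def)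
  moreover have "swap_img (a # p) s = (if fst a \<le> 8 then \<lambda>x. subst_comp ?V (swap_img p s) x else swap_img p s)"
    by (auto simp: fun_eq_iff)
  ultimately show ?case
    using Cons by (simp add: swap_act_def reduce_expand_reduce)
qed

text \<open>Actions are compared on the five generators; this carries the evaluated tables over to
  all elements.\<close>

lemma swap_act_cong:
  assumes "w \<in> carrier (free_group base_set)" "swap_sign p s = swap_sign p' s"
    and "\<And>x. x \<in> base_set \<Longrightarrow> swap_img p s x = swap_img p' s x"
  shows "foldr swap_act p (s, w) = foldr swap_act p' (s, w)"
  using assms reduce_expand_cong_on[of base_set "swap_img p s" "swap_img p' s" w]
  by (simp add: swap_act_eq carrier_free_group)

lemma vertex_iso_words: "i \<le> 8 \<Longrightarrow> x \<in> base_set \<Longrightarrow> vertex_iso i s x \<in> words base_set"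
  using swap_closed_check[unfolded list_all_iff, rule_format, of i s x]
  by (cases s) (auto simp: words_def)

interpretation swap: word_action swap_act "UNIV \<times> carrier (free_group base_set)"
proof
  fix a :: "nat letter" and x :: "bool \<times> nat letter list"
  assume "x \<in> UNIV \<times> carrier (free_group base_set)"
  then obtain s w where x: "x = (s, w)" "w \<in> carrier (free_group base_set)" by auto
  have "expand (vertex_iso (fst a) (\<not> s)) w \<in> words base_set" if "fst a \<le> 8"
    using that x(2) by (intro expand_in_words[of base_set]) (auto simp: vertex_iso_words carrier_free_group)
  with x show "swap_act a x \<in> UNIV \<times> carrier (free_group base_set)"
    by (auto simp: swap_act_def)
  have "foldr swap_act [(fst a, True), (fst a, True)] (s, w) = foldr swap_act [] (s, w)"
    using swap_involution_check[unfolded list_all_iff, rule_format, of "fst a" s] x(2)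
    by (intro swap_act_cong; cases "fst a \<le> 8"; cases s) auto
  then show "swap_act a (swap_act (inv_letter a) x) = x"
    by (cases "fst a \<le> 8") (simp_all add: x swap_act_def)
qed

lemma swap_act_gen_word:
  assumes "v \<in> words base_set" "w \<in> carrier (free_group base_set)"
  shows "foldr swap_act (expand gen_word v) (False, w) = (False, reduce (v @ w @ word_inv v))"
  using assms(1)
proof (induction v)
  case Nil
  then show ?case using assms(2) by (simp add: reduce_reduced carrier_free_group)
next
  case (Cons a v)
  let ?u = "reduce (v @ w @ word_inv v)"
  have u: "?u \<in> carrier (free_group base_set)"
    using Cons.prems assms(2) by (intro reduce_in_carrier) (simp add: carrier_free_group)
  \<comment> \<open>Each fibre generator is a product of an even number of reflections, so the flag
    is restored.\<close>
  have "swap_sign (letter_image gen_word a) False = False"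
    using Cons.prems by (auto simp: letter_image_def gen_word_def inv_letter_def base_set_eq)
  moreover have "reduce (expand (swap_img (letter_image gen_word a) False) ?u) = reduce (expand (inner [a]) ?u)"
  proof (rule reduce_expand_cong_on[of base_set])
    fix x :: nat assume "x \<in> base_set"
    then show "reduce (swap_img (letter_image gen_word a) False x) = reduce (inner [a] x)"
      using swap_gen_word_check[unfolded list_all_iff, rule_format, of "fst a" "snd a" x] Cons.prems
      by (simp split: bool.split)
  qed (use u in \<open>simp add: carrier_free_group\<close>)
  ultimately have "foldr swap_act (letter_image gen_word a) (False, ?u) = (False, reduce ([a] @ ?u @ word_inv [a]))"
    using u by (simp only: swap_act_eq reduced_reduce reduce_expand_inner)
  also have "reduce ([a] @ ?u @ word_inv [a]) = reduce ((a # v) @ w @ word_inv (a # v))"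
    unfolding reduce_infix by simp
  finally show ?case using Cons by simp
qed

definition raag_vertices :: "nat set" where
  "raag_vertices = {1..10}"

definition raag_edges :: "(nat \<times> nat) set" where
  "raag_edges = {(i, j). raag_adj i j}"

lemma graph_on_raag_edges: "graph_on 10 raag_edges"
  by (auto simp: graph_on_def raag_edges_def raag_adj_def cube_adj_def sym_def irrefl_def)

interpretation A: raag raag_vertices raag_edges raag_adj
  using graph_on_raag_edges by unfold_locales (auto simp: graph_on_def raag_edges_def raag_vertices_def)

lemma RAAG_eq: "RAAG 10 raag_edges = A.Q"
  by (simp add: RAAG_def raag_relators_def raag_vertices_def)

lemma gen_word_words: "x \<in> base_set \<union> stable_set \<Longrightarrow> gen_word x \<in> words raag_vertices"
  by (auto simp: gen_word_def base_set_eq stable_set_eq raag_vertices_def)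

lemma swap_trivial:
  assumes "p \<in> words raag_vertices" "A.cls p = \<one>\<^bsub>A.Q\<^esub>" "w \<in> carrier (free_group base_set)"
  shows "foldr swap_act p (s, w) = (s, w)"
proof -
  have "reduce p \<in> A.NC" using assms(1,2) A.cls_eq_one_iff by simp
  moreover have "foldr swap_act r x = x"
    if "r \<in> raag_relators raag_vertices raag_edges" "x \<in> UNIV \<times> carrier (free_group base_set)" for r x
  proof (rule A.relators_act_trivially[OF swap.word_action_axioms that])
    have cube: "swap_act (i, True) (swap_act (j, True) (s, w)) = swap_act (j, True) (swap_act (i, True) (s, w))"
      if "cube_adj i j" "w \<in> carrier (free_group base_set)" for i j s w
    proof -
      have "foldr swap_act [(i, True), (j, True)] (s, w) = foldr swap_act [(j, True), (i, True)] (s, w)"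
      proof (rule swap_act_cong[OF that(2)])
        fix x assume "x \<in> base_set"
        then show "swap_img [(i, True), (j, True)] s x = swap_img [(j, True), (i, True)] s x"
          using swap_commute_check[unfolded list_all_iff set_upt, rule_format, of i j s x] that(1)
          by (cases s) (simp_all add: cube_adj_def)
      qed simp
      then show ?thesis by simp
    qed
    fix i j and x :: "bool \<times> nat letter list"
    assume "(i, j) \<in> raag_edges" "x \<in> UNIV \<times> carrier (free_group base_set)"
    then show "swap_act (i, True) (swap_act (j, True) x) = swap_act (j, True) (swap_act (i, True) x)"
      using cube by (auto simp: raag_edges_def raag_adj_def) (auto simp: swap_act_def)
  qed
  ultimately have "foldr swap_act (reduce p) (s, w) = (s, w)"
    using swap.normal_closure_acts_trivially[OF A.relators] assms(3) by blast
  then show ?thesis using swap.act_reduce[of "(s, w)" p] assms(3) by simp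
qed

text \<open>A word trivial in the Artin group acts trivially, while \<open>v\<close> acts as
  conjugation by itself; so \<open>v\<close> is central in a free group of rank five.\<close>

lemma gen_word_faithful_base:
  assumes "v \<in> words base_set" "A.cls (expand gen_word v) = \<one>\<^bsub>A.Q\<^esub>"
  shows "reduce v = []"
proof (rule free_group_centreless[of _ base_set])
  fix x assume "x \<in> base_set"
  then have x: "[(x, True)] \<in> carrier (free_group base_set)" by (simp add: carrier_free_group reduced_def)
  have "expand gen_word v \<in> words raag_vertices"
    using assms(1) gen_word_words by (intro expand_in_words[of base_set]) auto
  from swap_trivial[OF this assms(2) x, of False]
  have "reduce (v @ [(x, True)] @ word_inv v) = [(x, True)]"
    unfolding swap_act_gen_word[OF assms(1) x] by simp
  also have "reduce (v @ [(x, True)] @ word_inv v) = reduce (reduce v @ [(x, True)] @ word_inv (reduce v))"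
    using reduce_append_right[of "reduce v @ [(x, True)]" "word_inv v"]
      reduce_append_left[of v "[(x, True)] @ word_inv v"]
    by (simp add: reduce_word_inv)
  finally show "reduce (reduce v @ [(x, True)] @ word_inv (reduce v)) = [(x, True)]" .
qed (use assms(1) in \<open>auto simp: base_list_def\<close>)

section \<open>Projection to the free factor\<close>

definition proj_act :: "nat letter \<Rightarrow> nat letter list \<Rightarrow> nat letter list" where
  "proj_act a w = (if fst a \<ge> 9 then red_cons a w else w)"

interpretation proj: word_action proj_act "{w. reduced w}"
  by unfold_locales (auto simp: proj_act_def reduced_red_cons red_cons_inv)

lemma proj_act_base: "p \<in> words {..8} \<Longrightarrow> foldr proj_act p w = w"
  by (induction p) (auto simp: proj_act_def)

text \<open>The projection forgets the cube letters attached to the generator 10, so it recovers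
  \<open>u\<close>.\<close>

lemma proj_act_gen_word:
  assumes "u \<in> words stable_set" "reduced w"
  shows "foldr proj_act (expand gen_word u) w = foldr red_cons u w"
  using assms(1)
proof (induction u)
  case (Cons a u)
  then have "fst a = 9 \<or> fst a = 10" by (simp add: stable_set_eq)
  then have "foldr proj_act (letter_image gen_word a) y = red_cons a y" for y
    by (cases a) (auto simp: letter_image_def gen_word_def proj_act_def inv_letter_def)
  with Cons show ?case by simp
qed simp

lemma proj_trivial:
  assumes "p \<in> words raag_vertices" "A.cls p = \<one>\<^bsub>A.Q\<^esub>"
  shows "foldr proj_act p [] = []"
proof -
  have p: "reduce p \<in> A.NC" using assms A.cls_eq_one_iff by simp
  \<comment> \<open>As 9 and 10 are not adjacent, every edge has an end that acts trivially.\<close>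
  have relator: "foldr proj_act r x = x"
    if "r \<in> raag_relators raag_vertices raag_edges" "x \<in> {w. reduced w}" for r x
    by (rule A.relators_act_trivially[OF proj.word_action_axioms that])
      (auto simp: raag_edges_def raag_adj_def cube_adj_def proj_act_def)
  have "foldr proj_act (reduce p) [] = []"
    by (rule proj.normal_closure_acts_trivially[OF A.relators relator p]) auto
  then show ?thesis using proj.act_reduce[of "[]" p] by simp
qed

lemma stable_iso_props:
  assumes "fst c \<in> stable_set" "x \<in> base_set"
  shows "stable_iso c x \<in> words base_set" "length (stable_iso c x) \<le> 31"
    "reduce (expand (stable_iso c) (stable_iso (inv_letter c) x)) = [(x, True)]"
proof -
  have "c \<in> set [(9, True), (9, False), (10, True), (10, False)]"
    using assms(1) by (cases c; cases "snd c") (auto simp: stable_set_eq)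
  with stable_iso_check assms(2)
  have *: "list_all (\<lambda>a. a \<in> base_set) (map fst (stable_iso c x)) \<and> length (stable_iso c x) \<le> 31 \<and>
     reduce (expand (stable_iso c) (stable_iso (inv_letter c) x)) = [(x, True)]"
    unfolding list_all_iff[of _ base_list] list_all_iff[of _ "[_, _, _, _]"] by blast
  then show "stable_iso c x \<in> words base_set"
    by (auto simp: words_def list_all_iff)
  from * show "length (stable_iso c x) \<le> 31"
    "reduce (expand (stable_iso c) (stable_iso (inv_letter c) x)) = [(x, True)]" by blast+
qed

section \<open>The subgroup as a free-by-free group\<close>

interpretation P: free_by_free base_set stable_set stable_iso 31
  by unfold_locales (use stable_iso_props in auto)

interpretation P: faithful_free_by_free base_set stable_set stable_iso 31 A.Q "\<lambda>w. A.cls (expand gen_word w)"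
proof
  show "(\<lambda>w. A.cls (expand gen_word w)) \<in> hom (free_group (base_set \<union> stable_set)) A.Q"
  proof (rule homI)
    fix u v assume uv: "u \<in> carrier (free_group (base_set \<union> stable_set))" "v \<in> carrier (free_group (base_set \<union> stable_set))"
    then have words: "expand gen_word u \<in> words raag_vertices" "expand gen_word v \<in> words raag_vertices"
      using gen_word_words by (auto simp: carrier_free_group intro!: expand_in_words[of "base_set \<union> stable_set"])
    show "A.cls (expand gen_word u) \<in> carrier A.Q" using words by simp
    have "A.cls (expand gen_word (reduce (u @ v))) = A.cls (expand gen_word u @ expand gen_word v)"
      by (rule A.cls_cong) (simp add: reduce_expand_reduce)
    then show "A.cls (expand gen_word (u \<otimes>\<^bsub>free_group (base_set \<union> stable_set)\<^esub> v))
        = A.cls (expand gen_word u) \<otimes>\<^bsub>A.Q\<^esub> A.cls (expand gen_word v)"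
      using words by simp
  qed
next
  fix r assume "r \<in> P.Rel"
  then obtain z x where zx: "z \<in> stable_set" "x \<in> base_set"
    "r = reduce ([(z, True), (x, True), (z, False)] @ word_inv (stable_iso (z, True) x))" (is "r = reduce ?p")
    by (auto simp: P.Rel_def)
  have "?p \<in> words (base_set \<union> stable_set)"
    using zx stable_iso_props(1)[of "(z, True)" x] by (auto intro: words_mono[of base_set])
  then have "expand gen_word ?p \<in> words raag_vertices"
    using gen_word_words by (intro expand_in_words[of "base_set \<union> stable_set"])
  moreover have "shuffle raag_adj (expand gen_word ?p) = []"
    using gen_word_check[unfolded list_all_iff, rule_format, of z x] zx(1,2) by (simp add: stable_set_eq)
  ultimately have "A.cls (expand gen_word ?p) = \<one>\<^bsub>A.Q\<^esub>" by (rule A.cls_eq_one_if_shuffle)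
  moreover have "A.cls (expand gen_word r) = A.cls (expand gen_word ?p)"
    unfolding zx(3) by (rule A.cls_cong) (rule reduce_expand_reduce)
  ultimately show "A.cls (expand gen_word r) = \<one>\<^bsub>A.Q\<^esub>" by simp
next
  \<comment> \<open>The projection kills \<open>v\<close> and keeps \<open>u\<close>, so
    \<open>u\<close> is freely trivial; freeness of the fibre then settles \<open>v\<close>.\<close>
  fix v u assume vu: "v \<in> words base_set" "u \<in> words stable_set" 
    "A.cls (expand gen_word (reduce (v @ u))) = \<one>\<^bsub>A.Q\<^esub>"
  have words: "expand gen_word v \<in> words raag_vertices" "expand gen_word u \<in> words raag_vertices"
    by (rule expand_in_words[OF _ vu(1)], use gen_word_words in simp)
      (rule expand_in_words[OF _ vu(2)], use gen_word_words in simp)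
  have "A.cls (expand gen_word (v @ u)) = \<one>\<^bsub>A.Q\<^esub>"
    using vu(3) A.cls_cong[OF reduce_expand_reduce[of gen_word "v @ u"]] by simp
  then have "foldr proj_act (expand gen_word (v @ u)) [] = []"
    using words by (intro proj_trivial) auto
  moreover have "expand gen_word v \<in> words {..8}"
    using vu(1) by (intro expand_in_words[of base_set]) (auto simp: gen_word_def base_set_eq)
  ultimately have "reduce u = []"
    using vu(2) by (simp add: proj_act_base proj_act_gen_word reduce_def)
  then have eq: "reduce (v @ u) = reduce v"
    by (metis reduce_append_right append_Nil2)
  have "A.cls (expand gen_word v) = \<one>\<^bsub>A.Q\<^esub>"
    using vu(3) A.cls_cong[OF reduce_expand_reduce[of gen_word v]] unfolding eq by simp
  from gen_word_faithful_base[OF vu(1) this] show "reduce (v @ u) = []" unfolding eq .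
qed

section \<open>The lower bound\<close>

text \<open>The first two coordinates carry a quotient of the fibre isomorphic to the semidirect product of \<open>\<int>\<^sup>2\<close> and
  \<open>\<plusminus>1\<close>, on which the monodromy acts by the matrix with rows \<open>(1, 2)\<close> and \<open>(2, 5)\<close>. It comes from the sign
  character that is \<open>-1\<close> on all generators but the third, and from the factor \<open>x\<^sup>2 - 6 x + 1\<close> of the
  characteristic polynomial of the monodromy on the corresponding twisted homology.\<close>

fun affine_act :: "nat letter \<Rightarrow> int \<times> int \<times> int \<Rightarrow> int \<times> int \<times> int" where
  "affine_act (x, b) (p, q, z) =
    (if x = 1 then (- p, - q, - z)
     else if x = 2 then (- p, - q - 1, - z)
     else if x = 3 then (p, if b then q + 1 else q - 1, z)
     else if x = 4 then (1 - p, - q, - z)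
     else if x = 5 then (1 - p, 1 - q, - z)
     else if x = 9 then (p, q, if b then z + q else z - q)
     else if x = 10 then (if b then (p + 2 * q, 2 * p + 5 * q, z) else (5 * p - 2 * q, q - 2 * p, z))
     else (p, q, z))"

interpretation affine: word_action affine_act UNIV
  by unfold_locales (auto simp: inv_letter_def)

definition shifts :: "nat letter list \<Rightarrow> int \<Rightarrow> bool" where
  "shifts w k \<longleftrightarrow> (\<forall>p q z. foldr affine_act w (p, q, z) = (p, q, z + k))"

lemma shifts_reduce_iff: "shifts (reduce w) k \<longleftrightarrow> shifts w k"
  by (simp add: shifts_def affine.act_reduce)

lemma shifts_append: "shifts u k \<Longrightarrow> shifts v l \<Longrightarrow> shifts (u @ v) (k + l)"
  by (simp add: shifts_def)

lemma shifts_word_inv: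
  assumes "shifts w k" shows "shifts (word_inv w) (- k)"
  unfolding shifts_def
proof (intro allI)
  fix p q z
  have "foldr affine_act w (p, q, z - k) = (p, q, z)" using assms by (simp add: shifts_def)
  then show "foldr affine_act (word_inv w) (p, q, z) = (p, q, z + - k)"
    using affine.act_word_inv[of "(p, q, z - k)" w] by simp
qed

text \<open>The last coordinate never influences the others and enters each letter with coefficient
  1 or -1; these signs multiply along \<open>g\<close>.\<close>

lemma affine_act_shift:
  "\<exists>\<epsilon>\<in>{1, -1}. \<forall>p q z. foldr affine_act g (p, q, z + k) = 
     (case foldr affine_act g (p, q, z) of (p', q', z') \<Rightarrow> (p', q', z' + \<epsilon> * k))"
proof (induction g)
  case (Cons a g)
  then obtain \<epsilon> where \<epsilon>: "\<epsilon> \<in> {1, -1}" "\<And>p q z. foldr affine_act g (p, q, z + k) = 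
     (case foldr affine_act g (p, q, z) of (p', q', z') \<Rightarrow> (p', q', z' + \<epsilon> * k))" by blast
  obtain x b where a: "a = (x, b)" by fastforce
  show ?case
    using \<epsilon> by (intro bexI[of _ "if x \<in> {1, 2, 4, 5} then - \<epsilon> else \<epsilon>"])
      (auto simp: a split: prod.splits)
qed (intro bexI[of _ 1], auto)

text \<open>Up to sign, the translation contributed by a relator is independent of the conjugating
  word.\<close>

lemma shifts_conj:
  assumes "shifts r k" shows "\<exists>l. \<bar>l\<bar> = \<bar>k\<bar> \<and> shifts (g @ r @ word_inv g) l"
proof -
  obtain \<epsilon> where \<epsilon>: "\<epsilon> \<in> {1, -1}" "\<And>p q z. foldr affine_act g (p, q, z + k) = 
     (case foldr affine_act g (p, q, z) of (p', q', z') \<Rightarrow> (p', q', z' + \<epsilon> * k))"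
    using affine_act_shift[where g = g and k = k] by blast
  have "shifts (g @ r @ word_inv g) (\<epsilon> * k)"
    unfolding shifts_def
  proof (intro allI)
    fix p q z
    obtain p' q' z' where inv: "foldr affine_act (word_inv g) (p, q, z) = (p', q', z')"
      by (metis prod_cases3)
    moreover have "foldr affine_act g (p', q', z') = (p, q, z)"
      using affine.act_word_inv[of "(p, q, z)" "word_inv g"] inv by simp
    ultimately show "foldr affine_act (g @ r @ word_inv g) (p, q, z) = (p, q, z + \<epsilon> * k)"
      using assms \<epsilon>(2)[of p' q' z'] by (simp add: shifts_def)
  qed
  with \<epsilon>(1) show ?thesis by (intro exI[of _ "\<epsilon> * k"]) auto
qed

lemma relator_shifts:
  assumes "r \<in> P.Rel" shows "\<exists>k. \<bar>k\<bar> \<le> 1 \<and> shifts r k"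
proof -
  obtain z x where zx: "z \<in> stable_set" "x \<in> base_set"
    "r = reduce ([(z, True), (x, True), (z, False)] @ word_inv (stable_iso (z, True) x))"
    using assms by (auto simp: P.Rel_def)
  \<comment> \<open>Commuting \<open>x\<close> with the shear 9 leaves the constant by which
    \<open>x\<close> moves the second coordinate; the relators for 10 act trivially.\<close>
  have "shifts ([(z, True), (x, True), (z, False)] @ word_inv (stable_iso (z, True) x))
      (if z = 9 \<and> x = 2 then -1 else if z = 9 \<and> (x = 3 \<or> x = 5) then 1 else 0)"
    using zx(1,2) unfolding base_set_eq stable_set_eq
    by (auto simp: shifts_def stable_iso_def monodromy_def inv_letter_def algebra_simps)
  then show ?thesis unfolding zx(3) shifts_reduce_iff
    by (intro exI[of _ "if z = 9 \<and> x = 2 then -1 else if z = 9 \<and> (x = 3 \<or> x = 5) then 1 else 0"]) auto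
qed

text \<open>Turns the size of a translation into a lower bound for area, each relator contributing
  at most one.\<close>

lemma fills_shifts: "P.fills N w \<Longrightarrow> \<exists>k. \<bar>k\<bar> \<le> int N \<and> shifts w k"
proof (induction rule: P.fills.induct)
  case (trivial w N)
  have "shifts [] 0" by (simp add: shifts_def)
  then show ?case using trivial shifts_reduce_iff[of w 0] by (intro exI[of _ 0]) auto
next
  case (step g r N v w)
  have "\<exists>k. \<bar>k\<bar> \<le> 1 \<and> shifts r k"
  proof (cases "r \<in> P.Rel")
    case True
    then show ?thesis by (rule relator_shifts)
  next
    case False
    then obtain s k where "r = word_inv s" "\<bar>k\<bar> \<le> 1" "shifts s k"
      using step.hyps(2) relator_shifts by blast
    then show ?thesis using shifts_word_inv[of s k] by (intro exI[of _ "- k"]) auto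
  qed
  then obtain k l where kl: "\<bar>k\<bar> \<le> 1" "\<bar>l\<bar> = \<bar>k\<bar>" "shifts (g @ r @ word_inv g) l"
    using shifts_conj by blast
  obtain m where m: "\<bar>m\<bar> \<le> int N" "shifts v m" using step.IH by blast
  have "shifts w (l + m)"
    using shifts_append[OF kl(3) m(2)] shifts_reduce_iff[of w] shifts_reduce_iff[of "(g @ r @ word_inv g) @ v"]
      step.hyps(4) by simp
  with kl m show ?case by (intro exI[of _ "l + m"]) auto
qed

section \<open>Short words of exponential area\<close>

definition long_conjugate :: "nat \<Rightarrow> nat letter list" where
  "long_conjugate n = replicate n (10, True) @ [(3, True)] @ replicate n (10, False)"

definition hard_word :: "nat \<Rightarrow> nat letter list" where
  "hard_word n = [(9, True)] @ long_conjugate n @ [(9, False)] @ word_inv (long_conjugate n)"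

text \<open>Generator 3 is a unit translation along the second axis. Each conjugation applies the
  monodromy matrix to the translation vector, whose entries stay nonnegative while the second one
  grows at least fivefold.\<close>

lemma act_long_conjugate:
  "\<exists>x\<ge>0. \<exists>y\<ge>2 ^ n. \<forall>p q z. foldr affine_act (long_conjugate n) (p, q, z) = (p + x, q + y, z)"
proof (induction n)
  case 0
  show ?case by (intro exI[of _ 0] conjI exI[of _ 1]) (auto simp: long_conjugate_def)
next
  case (Suc n)
  then obtain x y where xy: "x \<ge> 0" "y \<ge> 2 ^ n"
    "\<And>p q z. foldr affine_act (long_conjugate n) (p, q, z) = (p + x, q + y, z)" by blast
  have eq: "long_conjugate (Suc n) = [(10, True)] @ long_conjugate n @ [(10, False)]"
    by (simp add: long_conjugate_def replicate_append_same)
  have "foldr affine_act (long_conjugate (Suc n)) (p, q, z) = (p + (x + 2 * y), q + (2 * x + 5 * y), z)" for p q z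
    unfolding eq by (simp add: xy(3) algebra_simps)
  moreover have "(2 :: int) ^ Suc n \<le> 2 * x + 5 * y" "0 \<le> x + 2 * y"
    using xy(1,2) zero_le_power[of "2 :: int" n] by (simp_all only: power_Suc) linarith+
  ultimately show ?case by blast
qed

text \<open>The commutator of the shear with a translation moves the last coordinate by the second
  component of that translation.\<close>

lemma hard_word_shifts: "\<exists>k \<ge> 2 ^ n. shifts (hard_word n) k"
proof -
  obtain x y where xy: "y \<ge> 2 ^ n"
    "\<And>p q z. foldr affine_act (long_conjugate n) (p, q, z) = (p + x, q + y, z)"
    using act_long_conjugate[of n] by blast
  have inv: "foldr affine_act (word_inv (long_conjugate n)) (p, q, z) = (p - x, q - y, z)" for p q z
    using affine.act_word_inv[of "(p - x, q - y, z)" "long_conjugate n"] by (simp add: xy(2))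
  have "shifts (hard_word n) y"
    by (simp add: shifts_def hard_word_def xy(2) inv)
  with xy(1) show ?thesis by blast
qed

text \<open>The long conjugate represents an element of the fibre, which commutes with the generator
  9.\<close>

lemma hard_word_trivial: "trivial_in (base_set \<union> stable_set) P.Rel (reduce (hard_word n))"
proof -
  let ?p = "long_conjugate n"
  obtain v where v: "v \<in> words base_set" "P.cls ?p = P.cls v"
    using P.cls_conj_stable_power[of "(10, True)" "[(3, True)]" n]
    by (auto simp: long_conjugate_def inv_letter_def base_set_eq stable_set_eq)
  have words: "v \<in> words (base_set \<union> stable_set)" "?p \<in> words (base_set \<union> stable_set)"
    using v(1) by (auto simp: long_conjugate_def words_def image_subset_iff base_set_eq stable_set_eq)
  have "P.cls ([(9, True)] @ ?p @ [(9, False)]) = P.cls ([(9, True)] @ v @ [(9, False)])"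
    by (rule P.cls_infix_cong[OF v(2)]) (use words in auto)
  also have "\<dots> = P.cls (expand (stable_iso (9, True)) v)"
    using P.cls_conj_stable[of "(9, True)" v] v(1) by (simp add: inv_letter_def)
  also have "\<dots> = P.cls v"
    using v(1) by (intro P.cls_cong reduce_expand_id[of base_set]) (auto simp: stable_iso_def reduce_reduced reduced_def)
  finally have "P.cls (([(9, True)] @ ?p @ [(9, False)]) @ word_inv ?p) = P.cls v \<otimes>\<^bsub>P.Q\<^esub> inv\<^bsub>P.Q\<^esub> P.cls v"
    using words v(2) by (subst P.cls_append) (simp_all add: P.cls_word_inv)
  then have "P.cls (hard_word n) = \<one>\<^bsub>P.Q\<^esub>"
    using words by (simp add: hard_word_def)
  moreover have "hard_word n \<in> words (base_set \<union> stable_set)"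
    using words by (simp add: hard_word_def)
  ultimately show ?thesis
    using P.cls_eq_one_iff P.relators by (simp add: trivial_in_iff)
qed

lemma exponential_le_dehn_function:
  "(\<lambda>k. 2 ^ k) \<preceq>\<^sub>D dehn_function (base_set \<union> stable_set) P.Rel"
  unfolding growth_le_def
proof (intro exI[of _ 4] conjI allI)
  fix n
  let ?w = "reduce (hard_word n)"
  obtain k where k: "k \<ge> 2 ^ n" "shifts ?w k" using hard_word_shifts shifts_reduce_iff by blast
  obtain l where l: "\<bar>l\<bar> \<le> int (area (base_set \<union> stable_set) P.Rel ?w)" "shifts ?w l"
    using fills_shifts[OF P.fills_area[OF hard_word_trivial]] by blast
  have "k = l" using k(2) l(2) by (auto simp: shifts_def)
  then have "2 ^ n \<le> int (area (base_set \<union> stable_set) P.Rel ?w)" using k(1) l(1) by linarith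
  then have "int (2 ^ n) \<le> int (area (base_set \<union> stable_set) P.Rel ?w)" by simp
  then have "2 ^ n \<le> area (base_set \<union> stable_set) P.Rel ?w" by (simp only: of_nat_le_iff)
  also have "\<dots> \<le> dehn_function (base_set \<union> stable_set) P.Rel (4 * n + 4)"
    unfolding dehn_function_def
  proof (rule Max_ge[OF finite_dehn_set])
    \<comment> \<open>Two conjugates of length \<open>2 * n + 1\<close> and two further letters;
      hence the constant 4.\<close>
    have "length ?w \<le> 4 * n + 4"
      using length_reduce[of "hard_word n"] by (simp add: hard_word_def long_conjugate_def)
    then show "area (base_set \<union> stable_set) P.Rel ?w \<in>
        {area (base_set \<union> stable_set) P.Rel w |w. trivial_in (base_set \<union> stable_set) P.Rel w \<and> length w \<le> 4 * n + 4}"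
      using hard_word_trivial by blast
  qed simp
  finally show "2 ^ n \<le> 4 * dehn_function (base_set \<union> stable_set) P.Rel (4 * n + 4) + 4 * n + 4" by simp
qed simp

theorem proposition7p1:
  shows "\<exists>(n :: nat) (E :: (nat \<times> nat) set) (P :: nat letter list set set)
           (X :: nat set) (R :: nat letter list set).
           graph_on n E \<and>
           subgroup P (RAAG n E) \<and>
           finite_presentation ((RAAG n E)\<lparr>carrier := P\<rparr>) X R \<and>
           dehn_function X R \<simeq>\<^sub>D (\<lambda>k. 2 ^ k)"
proof (intro exI conjI)
  show "graph_on 10 raag_edges" by (rule graph_on_raag_edges)
  show "subgroup ((\<lambda>w. A.cls (expand gen_word w)) ` carrier (free_group (base_set \<union> stable_set))) (RAAG 10 raag_edges)"
    unfolding RAAG_eq by (rule P.img_is_subgroup)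
  show "finite_presentation ((RAAG 10 raag_edges)\<lparr>carrier :=
      (\<lambda>w. A.cls (expand gen_word w)) ` carrier (free_group (base_set \<union> stable_set))\<rparr>) (base_set \<union> stable_set) P.Rel"
    unfolding RAAG_eq by (rule P.finite_presentation_image)
  show "dehn_function (base_set \<union> stable_set) P.Rel \<simeq>\<^sub>D (\<lambda>k. 2 ^ k)"
    unfolding growth_equiv_def
    using P.dehn_function_le_exponential exponential_le_dehn_function by blast
qed

end
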